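(* Let $\mathcal{L}$ be a subspace lattice on a Hilbert space $K$ and $\mathcal{M}$ an atomic Boolean subspace lattice on a Hilbert space $H$ having the rank one density property, with set of atoms $\mathcal{E}=\{E_j:j\in J\}$. Then $$\operatorname{Lat}\operatorname{Alg}(\mathcal{L}\otimes\mathcal{M})=(\operatorname{Lat}\operatorname{Alg}\mathcal{L})\otimes\mathcal{M}=\Big\{\bigvee_{j\in J}f(E_j)\otimes E_j : f\in m(\mathcal{E},\operatorname{Lat}\operatorname{Alg}\mathcal{L})\Big\}.$$
   Context: A subspace lattice on a Hilbert space is a set of orthogonal projections containing $0,I$, closed under $\wedge$ (intersection of ranges) and $\vee$ (closed span of ranges), and strongly closed. $\operatorname{Alg}\mathcal{L}$ is the algebra of bounded operators leaving every element of $\mathcal{L}$ invariant; $\operatorname{Lat}\mathcal{B}$ is the set of projections whose ranges are invariant under all operators in $\mathcal{B}$. An ABSL is a distributive complemented subspace lattice with a set of atoms (minimal nonzero elements) such that every element is the join of a subfamily of atoms. Rank one density property: span of rank one operators in $\operatorname{Alg}\mathcal{M}$ is weak* dense in $\operatorname{Alg}\mathcal{M}$. For subspace lattices $\mathcal{L}_1,\mathcal{L}_2$, $\mathcal{L}_1\otimes\mathcal{L}_2$ is the subspace lattice generated by $L_1\otimes L_2$. $m(\mathcal{E},\mathcal{N})$ is the set of all maps from $\mathcal{E}$ to $\mathcal{N}$. *)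

theory Defs
  imports "HOL-Analysis.Analysis"
begin

text \<open>A complex Hilbert space is modelled as a real Hilbert space (type class
  real_inner + complete_space) together with a complex structure J
  (multiplication by the imaginary unit), which is real-linear, J o J = -id,
  and isometric for the real inner product.\<close>

definition cstruct :: "('a::{real_inner,complete_space} \<Rightarrow> 'a) \<Rightarrow> bool" where
  "cstruct J \<longleftrightarrow> linear J \<and> (\<forall>x. J (J x) = - x) \<and> (\<forall>x y. inner (J x) (J y) = inner x y)"

text \<open>Complex scalar multiplication and the complex inner product
  (linear in the first, conjugate-linear in the second argument).\<close>
definition cscale :: "('a::real_inner \<Rightarrow> 'a) \<Rightarrow> complex \<Rightarrow> 'a \<Rightarrow> 'a" where
  "cscale J z x = Re z *\<^sub>R x + Im z *\<^sub>R J x"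

definition cinner :: "('a::real_inner \<Rightarrow> 'a) \<Rightarrow> 'a \<Rightarrow> 'a \<Rightarrow> complex" where
  "cinner J x y = Complex (inner x y) (inner x (J y))"

definition cblin :: "('a::real_inner \<Rightarrow> 'a) \<Rightarrow> ('a \<Rightarrow> 'a) \<Rightarrow> bool" where
  "cblin J T \<longleftrightarrow> bounded_linear T \<and> (\<forall>x. T (J x) = J (T x))"

definition is_proj :: "('a::real_inner \<Rightarrow> 'a) \<Rightarrow> ('a \<Rightarrow> 'a) \<Rightarrow> bool" where
  "is_proj J P \<longleftrightarrow> cblin J P \<and> (\<forall>x. P (P x) = P x) \<and>
     (\<forall>x y. cinner J (P x) y = cinner J x (P y))"

definition cspan :: "'a::real_normed_vector set \<Rightarrow> 'a set" where
  "cspan S = closure (span S)"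

definition sot_closure :: "('a::real_normed_vector \<Rightarrow> 'a) set \<Rightarrow> ('a \<Rightarrow> 'a) set" where
  "sot_closure S = {T. \<forall>F. finite F \<longrightarrow> (\<forall>e>0. \<exists>A\<in>S. \<forall>x\<in>F. norm (T x - A x) < e)}"

definition subspace_lattice :: "('a::{real_inner,complete_space} \<Rightarrow> 'a) \<Rightarrow> ('a \<Rightarrow> 'a) set \<Rightarrow> bool" where
  "subspace_lattice J L \<longleftrightarrow>
     (\<forall>P\<in>L. is_proj J P) \<and> (\<lambda>x. 0) \<in> L \<and> id \<in> L \<and>
     (\<forall>P\<in>L. \<forall>Q\<in>L. \<exists>R\<in>L. range R = range P \<inter> range Q) \<and>
     (\<forall>P\<in>L. \<forall>Q\<in>L. \<exists>R\<in>L. range R = cspan (range P \<union> range Q)) \<and>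
     sot_closure L \<subseteq> L"

definition Alg :: "('a::real_inner \<Rightarrow> 'a) \<Rightarrow> ('a \<Rightarrow> 'a) set \<Rightarrow> ('a \<Rightarrow> 'a) set" where
  "Alg J L = {T. cblin J T \<and> (\<forall>P\<in>L. T ` range P \<subseteq> range P)}"

definition Lat :: "('a::real_inner \<Rightarrow> 'a) \<Rightarrow> ('a \<Rightarrow> 'a) set \<Rightarrow> ('a \<Rightarrow> 'a) set" where
  "Lat J B = {P. is_proj J P \<and> (\<forall>T\<in>B. T ` range P \<subseteq> range P)}"

definition atoms :: "('a::real_vector \<Rightarrow> 'a) set \<Rightarrow> ('a \<Rightarrow> 'a) set" where
  "atoms M = {E\<in>M. E \<noteq> (\<lambda>x. 0) \<and>
      (\<forall>Q\<in>M. range Q \<subseteq> range E \<longrightarrow> Q = (\<lambda>x. 0) \<or> Q = E)}"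

definition ABSL :: "('a::{real_inner,complete_space} \<Rightarrow> 'a) \<Rightarrow> ('a \<Rightarrow> 'a) set \<Rightarrow> bool" where
  "ABSL J M \<longleftrightarrow> subspace_lattice J M \<and>
     (\<forall>P\<in>M. \<forall>Q\<in>M. \<forall>R\<in>M.
        range P \<inter> cspan (range Q \<union> range R) =
        cspan ((range P \<inter> range Q) \<union> (range P \<inter> range R))) \<and>
     (\<forall>P\<in>M. \<exists>Q\<in>M. range P \<inter> range Q = {0} \<and> cspan (range P \<union> range Q) = UNIV) \<and>
     (\<forall>P\<in>M. \<exists>A\<subseteq>atoms M. range P = cspan (\<Union>E\<in>A. range E))"

definition rank_one :: "('a::real_inner \<Rightarrow> 'a) \<Rightarrow> ('a \<Rightarrow> 'a) \<Rightarrow> bool" where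
  "rank_one J T \<longleftrightarrow> cblin J T \<and> T \<noteq> (\<lambda>x. 0) \<and> (\<exists>v. \<forall>x. \<exists>z. T x = cscale J z v)"

definition op_cspan :: "('a::real_inner \<Rightarrow> 'a) \<Rightarrow> ('a \<Rightarrow> 'a) set \<Rightarrow> ('a \<Rightarrow> 'a) set" where
  "op_cspan J S = {T. \<exists>F c. finite F \<and> F \<subseteq> S \<and> T = (\<lambda>x. \<Sum>A\<in>F. cscale J (c A) (A x))}"

text \<open>Weak* (sigma-weak) closure: the weak* topology on B(H) is the topology
  induced by the normal functionals A \<mapsto> sum_n <A x_n, y_n> with
  sum_n ||x_n||^2 < inf and sum_n ||y_n||^2 < inf.\<close>
definition sq_summable_seq :: "(nat \<Rightarrow> 'a::real_normed_vector) \<Rightarrow> bool" where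
  "sq_summable_seq x \<longleftrightarrow> summable (\<lambda>n. (norm (x n))\<^sup>2)"

definition wstar_closure :: "('a::real_inner \<Rightarrow> 'a) \<Rightarrow> ('a \<Rightarrow> 'a) set \<Rightarrow> ('a \<Rightarrow> 'a) set" where
  "wstar_closure J S = {T. \<forall>W. finite W \<longrightarrow>
      (\<forall>(x, y)\<in>W. sq_summable_seq x \<and> sq_summable_seq y) \<longrightarrow>
      (\<forall>e>0. \<exists>A\<in>S. \<forall>(x, y)\<in>W.
          norm (\<Sum>n. cinner J (T (x n) - A (x n)) (y n)) < e)}"

definition rank_one_density :: "('a::real_inner \<Rightarrow> 'a) \<Rightarrow> ('a \<Rightarrow> 'a) set \<Rightarrow> bool" where
  "rank_one_density J M \<longleftrightarrow>
     Alg J M \<subseteq> wstar_closure J (op_cspan J {T\<in>Alg J M. rank_one J T})"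

text \<open>Hilbert space tensor product K \<otimes> H, given as a space T with a complex
  bilinear map tp whose elementary tensors have the product inner product and
  span a dense subspace (this determines T up to unitary equivalence).\<close>
definition is_tensor_product ::
  "('k::{real_inner,complete_space} \<Rightarrow> 'k) \<Rightarrow> ('h::{real_inner,complete_space} \<Rightarrow> 'h) \<Rightarrow>
   ('t::{real_inner,complete_space} \<Rightarrow> 't) \<Rightarrow> ('k \<Rightarrow> 'h \<Rightarrow> 't) \<Rightarrow> bool" where
  "is_tensor_product JK JH JT tp \<longleftrightarrow>
     (\<forall>y. linear (\<lambda>x. tp x y)) \<and> (\<forall>x. linear (tp x)) \<and>
     (\<forall>x y. tp (JK x) y = JT (tp x y) \<and> tp x (JH y) = JT (tp x y)) \<and>
     (\<forall>x y x' y'. cinner JT (tp x y) (tp x' y') = cinner JK x x' * cinner JH y y') \<and>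
     cspan (range (case_prod tp)) = UNIV"

definition tensor_op :: "('k \<Rightarrow> 'h \<Rightarrow> 't::real_normed_vector) \<Rightarrow> ('k \<Rightarrow> 'k) \<Rightarrow> ('h \<Rightarrow> 'h) \<Rightarrow> ('t \<Rightarrow> 't)" where
  "tensor_op tp A B = (THE C. bounded_linear C \<and> (\<forall>x y. C (tp x y) = tp (A x) (B y)))"

definition tensor_lattice ::
  "('t::{real_inner,complete_space} \<Rightarrow> 't) \<Rightarrow> ('k \<Rightarrow> 'h \<Rightarrow> 't) \<Rightarrow>
   ('k \<Rightarrow> 'k) set \<Rightarrow> ('h \<Rightarrow> 'h) set \<Rightarrow> ('t \<Rightarrow> 't) set" where
  "tensor_lattice JT tp L1 L2 =
     \<Inter>{S. subspace_lattice JT S \<and> {tensor_op tp P Q | P Q. P \<in> L1 \<and> Q \<in> L2} \<subseteq> S}"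

end

theory Submission
  imports Defs
begin

text \<open>
  Call the three sets \<open>X\<close>, \<open>Y\<close> and \<open>S\<close>, in the order of the statement; the proof is the cycle
  \<open>X \<subseteq> S \<subseteq> Y \<subseteq> X\<close>.

  \<open>X \<subseteq> S\<close>: an operator \<open>\<langle>\<cdot>, u\<rangle> v\<close> belongs to \<open>Alg M\<close> iff, for some atom \<open>E\<close>, \<open>v \<in> E\<close> and \<open>u\<close> is orthogonal
  to all other atoms. For \<open>Z \<in> X\<close> let \<open>f(E)\<close> be the closed span of all \<open>A (C\<^sub>u z)\<close> with \<open>A \<in> Alg L\<close>,
  \<open>z \<in> Z\<close> and such \<open>u\<close>, where \<open>C\<^sub>u\<close> is the adjoint of \<open>x \<mapsto> x \<otimes> u\<close>. It is invariant under \<open>Alg L\<close>, and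
  \<open>f(E) \<otimes> E \<subseteq> Z\<close> because \<open>z \<mapsto> A (C\<^sub>u z) \<otimes> v\<close> is the operator \<open>A \<otimes> \<langle>\<cdot>, u\<rangle> v\<close>, which leaves \<open>Z\<close> invariant.
  Conversely a vector \<open>w\<close> orthogonal to all \<open>f(E) \<otimes> E\<close> is orthogonal to \<open>(I \<otimes> R) z\<close> for \<open>z \<in> Z\<close> and all
  rank one \<open>R \<in> Alg M\<close>, hence to \<open>z\<close> by the density property.

  \<open>S \<subseteq> Y\<close>: an arbitrary join is a strong limit of finite joins.

  \<open>Y \<subseteq> X\<close>: \<open>X\<close> is a subspace lattice, and it contains \<open>P \<otimes> Q\<close> for \<open>P \<in> Lat Alg L\<close> and \<open>Q \<in> M\<close> because the
  slices \<open>x \<mapsto> C\<^sub>u (A (x \<otimes> y))\<close> of an operator \<open>A \<in> Alg(L \<otimes> M)\<close> belong to \<open>Alg L\<close>.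
\<close>

section \<open>Orthogonal projections and adjoints\<close>

lemma eq_if_inner_eq:
  fixes a b :: "'a::real_inner"
  assumes "\<And>x. inner a x = inner b x"
  shows "a = b"
proof -
  have "inner (a - b) (a - b) = 0" using assms[of "a - b"] by (simp add: inner_diff_left)
  then show ?thesis by simp
qed

text \<open>Projection theorem: a minimising sequence for the distance from \<open>x\<close> to
  \<open>V\<close> is Cauchy by the parallelogram law, and its limit has orthogonal residual because
  moving it along any \<open>v\<close> cannot reduce the distance.\<close>

lemma orthogonal_decomposition_exists:
  fixes V :: "'a::{real_inner,complete_space} set"
  assumes V: "subspace V" "closed V"
  shows "\<exists>p\<in>V. \<forall>v\<in>V. inner (x - p) v = 0"
proof -
  define d where "d = infdist x V"
  have ne: "V \<noteq> {}" using V(1) subspace_0 by blast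
  have d0: "d \<ge> 0" by (simp add: d_def infdist_nonneg)
  have dle: "d \<le> norm (x - v)" if "v \<in> V" for v
    using infdist_le[OF that, of x] by (simp add: d_def dist_norm)
  have d2: "d\<^sup>2 \<le> (norm (x - v))\<^sup>2" if "v \<in> V" for v
    using dle[OF that] d0 by (rule power_mono)
  have "\<exists>p\<in>V. norm (x - p) < d + 1 / (real n + 1)" for n
  proof (rule ccontr)
    assume "\<not> ?thesis"
    then have "d + 1 / (real n + 1) \<le> dist x p" if "p \<in> V" for p
      using that by (auto simp: dist_norm not_less)
    then have "d + 1 / (real n + 1) \<le> d"
      unfolding d_def infdist_notempty[OF ne] using ne by (intro cINF_greatest) auto
    moreover have "1 / (real n + 1) > 0" by simp
    ultimately show False by linarith
  qed
  then obtain p where p: "\<And>n. p n \<in> V" "\<And>n. norm (x - p n) < d + 1 / (real n + 1)"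
    by metis
  have lim_n: "(\<lambda>n. norm (x - p n)) \<longlonglongrightarrow> d"
  proof (rule tendsto_sandwich)
    show "\<forall>\<^sub>F n in sequentially. d \<le> norm (x - p n)" using dle p(1) by simp
    show "\<forall>\<^sub>F n in sequentially. norm (x - p n) \<le> d + 1 / (real n + 1)"
      using p(2) by (simp add: less_imp_le)
    show "(\<lambda>n. d + 1 / (real n + 1)) \<longlonglongrightarrow> d"
      using tendsto_add[OF tendsto_const[of d] LIMSEQ_inverse_real_of_nat]
      by (simp add: inverse_eq_divide add.commute)
  qed simp
  \<comment> \<open>Parallelogram law for \<open>x - p m\<close> and \<open>x - p n\<close>; the
    midpoint of \<open>p m\<close> and \<open>p n\<close> lies in \<open>V\<close>, so its distance
    to \<open>x\<close> is at least \<open>d\<close>.\<close>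
  have par: "(norm (p m - p n))\<^sup>2 \<le> 2 * (norm (x - p m))\<^sup>2 + 2 * (norm (x - p n))\<^sup>2 - 4 * d\<^sup>2" for m n
  proof -
    have "(1/2) *\<^sub>R (p m + p n) \<in> V" using V(1) p(1) by (simp add: subspace_add subspace_scale)
    from d2[OF this] have "4 * d\<^sup>2 \<le> (norm (2 *\<^sub>R (x - (1/2) *\<^sub>R (p m + p n))))\<^sup>2"
      by (simp only: norm_scaleR) (simp add: power_mult_distrib)
    also have "2 *\<^sub>R (x - (1/2) *\<^sub>R (p m + p n)) = (x - p m) + (x - p n)"
      by (simp add: algebra_simps scaleR_2)
    finally have "4 * d\<^sup>2 \<le> (norm ((x - p m) + (x - p n)))\<^sup>2" .
    moreover have "(norm (p m - p n))\<^sup>2 + (norm ((x - p m) + (x - p n)))\<^sup>2 =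
        2 * (norm (x - p m))\<^sup>2 + 2 * (norm (x - p n))\<^sup>2"
      unfolding power2_norm_eq_inner by (simp add: algebra_simps inner_commute)
    ultimately show ?thesis by linarith
  qed
  have "Cauchy p"
  proof (rule CauchyI)
    fix e :: real assume e: "e > 0"
    have "(\<lambda>n. (norm (x - p n))\<^sup>2) \<longlonglongrightarrow> d\<^sup>2" using lim_n by (rule tendsto_power)
    moreover have "d\<^sup>2 < d\<^sup>2 + e\<^sup>2 / 4" using e by simp
    ultimately have "\<forall>\<^sub>F n in sequentially. (norm (x - p n))\<^sup>2 < d\<^sup>2 + e\<^sup>2 / 4"
      by (rule order_tendstoD(2))
    then obtain N where N: "\<And>n. n \<ge> N \<Longrightarrow> (norm (x - p n))\<^sup>2 < d\<^sup>2 + e\<^sup>2 / 4"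
      by (auto simp: eventually_sequentially)
    have "norm (p m - p n) < e" if "m \<ge> N" "n \<ge> N" for m n
    proof -
      have "(norm (p m - p n))\<^sup>2 < e\<^sup>2" using par[of m n] N[OF that(1)] N[OF that(2)] by linarith
      then show ?thesis using e by (simp add: power_less_imp_less_base)
    qed
    then show "\<exists>M. \<forall>m\<ge>M. \<forall>n\<ge>M. norm (p m - p n) < e" by blast
  qed
  then obtain q where q: "p \<longlonglongrightarrow> q" using Cauchy_convergent convergent_def by blast
  have qV: "q \<in> V" using closed_sequentially[OF V(2) p(1) q] .
  have "(\<lambda>n. norm (x - p n)) \<longlonglongrightarrow> norm (x - q)" using q by (intro tendsto_intros)
  then have nq: "norm (x - q) = d" using lim_n LIMSEQ_unique by blast
  have "inner (x - q) v = 0" if v: "v \<in> V" for v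
  proof (cases "v = 0")
    case False
    \<comment> \<open>This \<open>t\<close> minimises the norm of
      \<open>x - q - t *\<^sub>R v\<close>, so minimality of \<open>q\<close> forces the gain, the
      square of \<open>inner (x - q) v\<close> over \<open>inner v v\<close>, to vanish.\<close>
    define t where "t = inner (x - q) v / inner v v"
    have "q + t *\<^sub>R v \<in> V" using V(1) qV v by (simp add: subspace_add subspace_scale)
    from d2[OF this] have "(norm (x - q))\<^sup>2 \<le> (norm (x - q - t *\<^sub>R v))\<^sup>2"
      using nq by (simp add: algebra_simps)
    also have "\<dots> = (norm (x - q))\<^sup>2 - 2 * t * inner (x - q) v + t * t * inner v v"
      unfolding power2_norm_eq_inner by (simp add: algebra_simps inner_commute)
    also have "t * t * inner v v = t * inner (x - q) v" using False by (simp add: t_def)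
    finally have "t * inner (x - q) v \<le> 0" by simp
    then have "(inner (x - q) v)\<^sup>2 / inner v v \<le> 0" by (simp add: t_def power2_eq_square)
    then show ?thesis using False
      by (metis divide_le_0_iff inner_gt_zero_iff not_less power2_less_0 zero_eq_power2 order_antisym_conv zero_le_power2)
  qed simp
  then show ?thesis using qV by blast
qed

definition orth_proj :: "'a::{real_inner,complete_space} set \<Rightarrow> 'a \<Rightarrow> 'a" where
  "orth_proj V x = (SOME p. p \<in> V \<and> (\<forall>v\<in>V. inner (x - p) v = 0))"

lemma
  fixes V :: "'a::{real_inner,complete_space} set"
  assumes "subspace V" "closed V"
  shows orth_proj_in: "orth_proj V x \<in> V"
    and orth_proj_orthogonal: "v \<in> V \<Longrightarrow> inner (x - orth_proj V x) v = 0"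
proof -
  have "\<exists>p. p \<in> V \<and> (\<forall>v\<in>V. inner (x - p) v = 0)"
    using orthogonal_decomposition_exists[OF assms] by blast
  from someI_ex[OF this] show "orth_proj V x \<in> V"
    "v \<in> V \<Longrightarrow> inner (x - orth_proj V x) v = 0" by (auto simp: orth_proj_def)
qed

lemma orth_proj_eqI:
  fixes V :: "'a::{real_inner,complete_space} set"
  assumes V: "subspace V" "closed V" and p: "p \<in> V" "\<And>v. v \<in> V \<Longrightarrow> inner (x - p) v = 0"
  shows "orth_proj V x = p"
proof -
  let ?q = "orth_proj V x"
  have "?q - p \<in> V" using V(1) p(1) orth_proj_in[OF V] by (simp add: subspace_diff)
  then have "inner (x - p) (?q - p) - inner (x - ?q) (?q - p) = 0"
    using p(2) orth_proj_orthogonal[OF V] by simp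
  then have "inner (?q - p) (?q - p) = 0" by (simp flip: inner_diff_left)
  then show ?thesis by simp
qed

text \<open>A closed subspace is its own double orthogonal complement; the decisive test vector is
  the residual \<open>x - orth_proj V x\<close>.\<close>

lemma in_subspace_if_orthogonal:
  fixes V :: "'a::{real_inner,complete_space} set"
  assumes V: "subspace V" "closed V" and x: "\<And>w. (\<And>v. v \<in> V \<Longrightarrow> inner v w = 0) \<Longrightarrow> inner x w = 0"
  shows "x \<in> V"
proof -
  let ?q = "orth_proj V x"
  have "inner x (x - ?q) = 0" using orth_proj_orthogonal[OF V] by (intro x) (simp add: inner_commute)
  moreover have "inner ?q (x - ?q) = 0"
    using orth_proj_orthogonal[OF V orth_proj_in[OF V]] by (simp add: inner_commute)
  ultimately have "inner (x - ?q) (x - ?q) = 0" by (simp add: inner_diff_left)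
  then show ?thesis using orth_proj_in[OF V, of x] by simp
qed

lemma orth_proj_inner:
  fixes V :: "'a::{real_inner,complete_space} set"
  assumes "subspace V" "closed V"
  shows "inner (orth_proj V x) y = inner x (orth_proj V y)"
proof -
  have "inner (x - orth_proj V x) (orth_proj V y) = 0" "inner (y - orth_proj V y) (orth_proj V x) = 0"
    using assms orth_proj_in orth_proj_orthogonal by blast+
  then show ?thesis
    by (simp add: inner_diff_left inner_commute[of y] inner_commute[of "orth_proj V y"])
qed

lemma norm_orth_proj_le:
  fixes V :: "'a::{real_inner,complete_space} set"
  assumes "subspace V" "closed V"
  shows "norm (orth_proj V x) \<le> norm x"
proof -
  have "inner (x - orth_proj V x) (orth_proj V x) = 0"
    using assms orth_proj_in orth_proj_orthogonal by blast
  then have "(norm (orth_proj V x))\<^sup>2 = inner x (orth_proj V x)"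
    by (simp add: power2_norm_eq_inner inner_diff_left)
  also have "\<dots> \<le> norm x * norm (orth_proj V x)" by (rule norm_cauchy_schwarz)
  finally show ?thesis
    by (metis mult_le_cancel_right norm_ge_zero norm_le_zero_iff power2_eq_square order_less_le)
qed

lemma bounded_linear_orth_proj:
  fixes V :: "'a::{real_inner,complete_space} set"
  assumes V: "subspace V" "closed V"
  shows "bounded_linear (orth_proj V)"
proof (rule bounded_linear_intro[where K = 1])
  note orth = orth_proj_orthogonal[OF V]
  show "orth_proj V (x + y) = orth_proj V x + orth_proj V y" for x y
    using V orth_proj_in[OF V] orth[of _ x] orth[of _ y]
    by (intro orth_proj_eqI) (auto simp: subspace_add inner_diff_left inner_add_left)
  show "orth_proj V (r *\<^sub>R x) = r *\<^sub>R orth_proj V x" for r x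
    using V orth_proj_in[OF V] orth[of _ x]
    by (intro orth_proj_eqI) (auto simp: subspace_scale inner_diff_left)
  show "norm (orth_proj V x) \<le> norm x * 1" for x using norm_orth_proj_le[OF V] by simp
qed

lemma orth_proj_nearest:
  fixes V :: "'a::{real_inner,complete_space} set"
  assumes V: "subspace V" "closed V" and y: "y \<in> V"
  shows "norm (x - orth_proj V x) \<le> norm (x - y)"
proof -
  let ?q = "orth_proj V x"
  have "inner (x - ?q) (?q - y) = 0"
    using V y orth_proj_in[OF V] by (intro orth_proj_orthogonal) (auto simp: subspace_diff)
  then have "(norm (x - ?q + (?q - y)))\<^sup>2 = (norm (x - ?q))\<^sup>2 + (norm (?q - y))\<^sup>2"
    by (intro norm_add_Pythagorean) (simp add: orthogonal_def)
  then have "(norm (x - ?q))\<^sup>2 \<le> (norm (x - y))\<^sup>2" by simp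
  then show ?thesis by simp
qed

section \<open>Riesz representation and adjoints\<close>

text \<open>A nonzero functional is determined by its value on one vector \<open>b\<close>
  orthogonal to its kernel, since \<open>x - (f x / f b) *\<^sub>R b\<close> lies in the
  kernel.\<close>

lemma riesz_representation:
  fixes f :: "'a::{real_inner,complete_space} \<Rightarrow> real"
  assumes f: "bounded_linear f"
  shows "\<exists>u. \<forall>x. f x = inner u x"
proof (cases "\<forall>x. f x = 0")
  case True
  then show ?thesis by (intro exI[of _ 0]) simp
next
  case False
  then obtain a where a: "f a \<noteq> 0" by blast
  interpret f: bounded_linear f by fact
  let ?V = "{x. f x = 0}"
  have V: "subspace ?V" "closed ?V"
    by (auto simp: subspace_def f.add f.scaleR f.zero intro!: closed_Collect_eq
        linear_continuous_on[OF f] continuous_intros)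
  define b where "b = a - orth_proj ?V a"
  have fb: "f b = f a" using orth_proj_in[OF V, of a] by (simp add: b_def f.diff)
  have b0: "inner b b \<noteq> 0" using fb a f.zero by (metis inner_eq_zero_iff)
  have "f x = inner ((f b / inner b b) *\<^sub>R b) x" for x
  proof -
    have "f (x - (f x / f b) *\<^sub>R b) = 0" using fb a by (simp add: f.diff f.scaleR)
    then have "inner b (x - (f x / f b) *\<^sub>R b) = 0"
      unfolding b_def by (intro orth_proj_orthogonal[OF V]) simp
    then show ?thesis using b0 a fb by (simp add: inner_diff_right field_simps)
  qed
  then show ?thesis by blast
qed

lemma hilbert_adjoint:
  fixes f :: "'a::{real_inner,complete_space} \<Rightarrow> 'b::{real_inner,complete_space}"
  assumes f: "bounded_linear f"
  shows inner_adjoint: "inner (adjoint f z) x = inner z (f x)"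
    and bounded_linear_adjoint: "bounded_linear (adjoint f)"
proof -
  have "\<exists>u. \<forall>x. inner z (f x) = inner u x" for z
    by (intro riesz_representation bounded_linear_inner_right_comp f)
  \<comment> \<open>\<open>adjoint\<close> is defined by choice, so its characteristic equation is
    available only once some adjoint is known to exist.\<close>
  then have "\<exists>g. \<forall>x y. inner (f x) y = inner x (g y)" by (metis inner_commute)
  then have ad: "\<forall>x y. inner (f x) y = inner x (adjoint f y)"
    unfolding adjoint_def by (rule someI_ex)
  then show in_ad: "inner (adjoint f z) x = inner z (f x)" for z x by (simp add: inner_commute)
  obtain B where B: "\<And>x. norm (f x) \<le> norm x * B" "0 < B" using bounded_linear.pos_bounded[OF f] by blast
  show "bounded_linear (adjoint f)"
  proof (rule bounded_linear_intro[where K = B])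
    show "adjoint f (x + y) = adjoint f x + adjoint f y" for x y
      by (rule eq_if_inner_eq) (simp add: in_ad inner_add_left)
    show "adjoint f (r *\<^sub>R x) = r *\<^sub>R adjoint f x" for r x
      by (rule eq_if_inner_eq) (simp add: in_ad)
    show "norm (adjoint f x) \<le> norm x * B" for x
    proof -
      have "(norm (adjoint f x))\<^sup>2 = inner x (f (adjoint f x))"
        by (simp add: power2_norm_eq_inner in_ad)
      also have "\<dots> \<le> norm x * norm (f (adjoint f x))" by (rule norm_cauchy_schwarz)
      also have "\<dots> \<le> norm x * (norm (adjoint f x) * B)" by (intro mult_left_mono B norm_ge_zero)
      finally have "norm (adjoint f x) * norm (adjoint f x) \<le> (norm x * B) * norm (adjoint f x)"
        by (simp add: power2_eq_square mult_ac)
      then show ?thesis using B(2)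
        by (cases "adjoint f x = 0") simp_all
    qed
  qed
qed

section \<open>Complex subspaces and invariant subspace lattices\<close>

text \<open>Closed complex subspaces, which for a complex structure \<open>J\<close> are exactly the
  ranges of the projections in the sense of \<open>is_proj\<close>.\<close>

definition csubspace :: "('a::real_normed_vector \<Rightarrow> 'a) \<Rightarrow> 'a set \<Rightarrow> bool" where
  "csubspace J V \<longleftrightarrow> subspace V \<and> closed V \<and> (\<forall>x\<in>V. J x \<in> V)"

lemma csubspaceD:
  assumes "csubspace J V"
  shows "subspace V" "closed V" "x \<in> V \<Longrightarrow> J x \<in> V"
  using assms by (auto simp: csubspace_def)

lemma csubspace_zero_mem: "csubspace J V \<Longrightarrow> 0 \<in> V"
  using csubspaceD(1) subspace_0 by blast

lemma csubspace_cscale: "csubspace J V \<Longrightarrow> x \<in> V \<Longrightarrow> cscale J z x \<in> V"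
  by (simp add: cscale_def csubspace_def subspace_add subspace_scale)

lemma csubspace_Int: "csubspace J V \<Longrightarrow> csubspace J W \<Longrightarrow> csubspace J (V \<inter> W)"
  by (auto simp: csubspace_def subspace_inter)

lemma subspace_cspan: "subspace (cspan S)"
  unfolding subspace_def
proof (intro conjI allI ballI)
  show "0 \<in> cspan S" unfolding cspan_def using closure_subset span_zero by blast
  show "x + y \<in> cspan S" if "x \<in> cspan S" "y \<in> cspan S" for x y
    using that unfolding cspan_def closure_sequential
    by (metis (no_types, lifting) span_add tendsto_add)
  show "r *\<^sub>R x \<in> cspan S" if "x \<in> cspan S" for r x
    using that unfolding cspan_def closure_sequential
    by (metis (no_types, lifting) span_scale tendsto_scaleR tendsto_const)
qed

lemma closed_cspan: "closed (cspan S)"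
  by (simp add: cspan_def)

lemma subset_cspan: "S \<subseteq> cspan S"
  unfolding cspan_def using span_superset closure_subset by blast

lemma cspan_base: "x \<in> S \<Longrightarrow> x \<in> cspan S"
  using subset_cspan by blast

lemma cspan_minimal: "S \<subseteq> V \<Longrightarrow> subspace V \<Longrightarrow> closed V \<Longrightarrow> cspan S \<subseteq> V"
  unfolding cspan_def by (intro closure_minimal span_minimal)

lemma cspan_mono: "S \<subseteq> S' \<Longrightarrow> cspan S \<subseteq> cspan S'"
  unfolding cspan_def by (intro closure_mono span_mono)

text \<open>The preimage of \<open>V\<close> under \<open>T\<close> is a closed subspace. This
  reduces invariance of a closed span to its generators and, with \<open>V = {0}\<close>, shows that
  a map vanishing on generators vanishes on their closed span.\<close>

lemma bounded_linear_cspan_subset: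
  assumes T: "bounded_linear T" and S: "T ` S \<subseteq> V" and V: "subspace V" "closed V"
  shows "T ` cspan S \<subseteq> V"
proof -
  interpret T: bounded_linear T by fact
  have "subspace (T -` V)" using V(1) by (auto simp: subspace_def T.add T.scaleR T.zero)
  moreover have "closed (T -` V)"
    using V(2) linear_continuous_at[OF T] by (intro continuous_closed_vimage)
  ultimately have "cspan S \<subseteq> T -` V" using S by (intro cspan_minimal) auto
  then show ?thesis by blast
qed

lemma cstructD:
  assumes "cstruct J"
  shows "linear J" "J (J x) = - x" "inner (J x) (J y) = inner x y"
    "inner (J x) y = - inner x (J y)" "inner x (J x) = 0" "norm (J x) = norm x"
    "J (x + y) = J x + J y" "J (x - y) = J x - J y" "J (- x) = - J x" "J (r *\<^sub>R x) = r *\<^sub>R J x"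
    "J 0 = 0"
proof -
  show J: "linear J" "J (J x) = - x" "inner (J x) (J y) = inner x y" for x y
    using assms by (auto simp: cstruct_def)
  show sk: "inner (J x) y = - inner x (J y)" for x y
    using J(3)[of "J x" y] J(2)[of x] by simp
  show "inner x (J x) = 0" using sk[of x x] by (simp add: inner_commute)
  show "norm (J x) = norm x" by (simp add: norm_eq_sqrt_inner J(3))
  show "J (x + y) = J x + J y" "J (x - y) = J x - J y" "J (- x) = - J x" "J (r *\<^sub>R x) = r *\<^sub>R J x"
    "J 0 = 0"
    using J(1) by (simp_all add: linear_add linear_diff linear_neg linear_scale linear_0)
qed

lemma bounded_linear_cstruct:
  assumes "cstruct J"
  shows "bounded_linear J"
  using cstructD[OF assms] by (intro bounded_linear_intro[where K = 1]) auto

lemma csubspace_cspan: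
  assumes J: "cstruct J" and "\<And>x. x \<in> S \<Longrightarrow> J x \<in> cspan S"
  shows "csubspace J (cspan S)"
proof -
  have "J ` cspan S \<subseteq> cspan S"
    using assms by (intro bounded_linear_cspan_subset bounded_linear_cstruct subspace_cspan closed_cspan) auto
  then show ?thesis by (auto simp: csubspace_def subspace_cspan closed_cspan)
qed

lemma csubspace_cspan_Union:
  assumes "cstruct J" and "\<And>V. V \<in> \<V> \<Longrightarrow> csubspace J V"
  shows "csubspace J (cspan (\<Union>\<V>))"
  using assms by (intro csubspace_cspan) (auto intro!: cspan_base dest: csubspaceD)

section \<open>Projections and their ranges\<close>

lemma is_projD:
  assumes "is_proj J P"
  shows "bounded_linear P" "P (J x) = J (P x)" "P (P x) = P x" "inner (P x) y = inner x (P y)"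
  using assms by (auto simp: is_proj_def cblin_def cinner_def)

lemma is_proj_fixed_iff: "is_proj J P \<Longrightarrow> x \<in> range P \<longleftrightarrow> P x = x"
  by (metis is_projD(3) rangeE rangeI)

lemma is_proj_csubspace:
  assumes P: "is_proj J P"
  shows "csubspace J (range P)"
proof -
  interpret P: bounded_linear P using P by (rule is_projD)
  have eq: "range P = {x. P x = x}" using is_proj_fixed_iff[OF P] by blast
  show ?thesis unfolding csubspace_def eq
    using P.continuous_on[OF continuous_on_id]
    by (auto simp: subspace_def P.add P.scaleR P.zero is_projD(2)[OF P] intro!: closed_Collect_eq)
qed

text \<open>A projection is determined by its range, so lattice questions about projections become
  questions about closed subspaces.\<close>

lemma is_proj_eq_orth_proj:
  assumes P: "is_proj J P"
  shows "P = orth_proj (range P)"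
proof
  fix x
  interpret P: bounded_linear P using P by (rule is_projD)
  have "inner (x - P x) v = 0" if "v \<in> range P" for v
  proof -
    have "inner (x - P x) v = inner (P (x - P x)) v"
      using that is_projD(4)[OF P] is_proj_fixed_iff[OF P] by metis
    then show ?thesis by (simp add: P.diff is_projD(3)[OF P])
  qed
  then show "P x = orth_proj (range P) x"
    using is_proj_csubspace[OF P] by (intro orth_proj_eqI[symmetric]) (auto dest: csubspaceD)
qed

lemma range_orth_proj:
  fixes V :: "'a::{real_inner,complete_space} set"
  assumes V: "subspace V" "closed V"
  shows "range (orth_proj V) = V"
proof -
  have "orth_proj V x = x" if "x \<in> V" for x using that V by (intro orth_proj_eqI) auto
  then show ?thesis using orth_proj_in[OF V] by (metis image_subset_iff rangeI subsetI subset_antisym)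
qed

lemma is_proj_orth_proj:
  assumes J: "cstruct J" and V: "csubspace J V"
  shows "is_proj J (orth_proj V)" "range (orth_proj V) = V"
proof -
  note VD = csubspaceD[OF V]
  have J_eq: "orth_proj V (J x) = J (orth_proj V x)" for x
  proof (rule orth_proj_eqI[OF VD(1,2)])
    show "J (orth_proj V x) \<in> V" using VD orth_proj_in[OF VD(1,2)] by blast
    show "inner (J x - J (orth_proj V x)) v = 0" if "v \<in> V" for v
      using orth_proj_orthogonal[OF VD(1,2) VD(3)[OF that], of x] cstructD[OF J]
      by (simp flip: cstructD(8)[OF J])
  qed
  show rg: "range (orth_proj V) = V" using VD(1,2) by (rule range_orth_proj)
  have "orth_proj V (orth_proj V x) = orth_proj V x" for x
    using orth_proj_in[OF VD(1,2)] VD by (intro orth_proj_eqI) auto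
  then show "is_proj J (orth_proj V)"
    using bounded_linear_orth_proj[OF VD(1,2)] J_eq orth_proj_inner[OF VD(1,2)]
    by (auto simp: is_proj_def cblin_def cinner_def simp flip: J_eq)
qed

lemma norm_is_proj_le:
  fixes J :: "'a::{real_inner,complete_space} \<Rightarrow> 'a"
  shows "is_proj J P \<Longrightarrow> norm (P x) \<le> norm x"
  by (metis csubspaceD(1,2) is_proj_csubspace is_proj_eq_orth_proj norm_orth_proj_le)

section \<open>Strong limits and subspace lattices\<close>

text \<open>Turns the epsilon definition of strong closure into convergence along a filter, so that
  the usual limit rules apply. The filter base is indexed by pairs of a finite set of vectors and a
  tolerance.\<close>

lemma sot_closure_filter:
  assumes "T \<in> sot_closure S"
  obtains F where "F \<noteq> bot" "\<forall>\<^sub>F A in F. A \<in> S" "\<And>x. ((\<lambda>A. A x) \<longlongrightarrow> T x) F"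
proof -
  define I where "I = {(X :: 'a set, e :: real). finite X \<and> e > 0}"
  define B where "B = (\<lambda>(X, e). {A \<in> S. \<forall>x\<in>X. norm (T x - A x) < e})"
  define F where "F = (INF i\<in>I. principal (B i))"
  have ev: "eventually P F \<longleftrightarrow> (\<exists>i\<in>I. \<forall>A\<in>B i. P A)" for P
    unfolding F_def
  proof (subst eventually_INF_base)
    show "I \<noteq> {}" by (auto simp: I_def intro!: exI[of _ "{}"] exI[of _ 1])
    fix i j assume "i \<in> I" "j \<in> I"
    then show "\<exists>k\<in>I. principal (B k) \<le> inf (principal (B i)) (principal (B j))"
      by (intro bexI[of _ "(fst i \<union> fst j, min (snd i) (snd j))"]) (auto simp: I_def B_def)
  qed (auto simp: eventually_principal)
  have "F \<noteq> bot"
  proof -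
    have "B i \<noteq> {}" if "i \<in> I" for i
      using assms that by (fastforce simp: sot_closure_def I_def B_def)
    then show ?thesis unfolding trivial_limit_def ev by blast
  qed
  moreover have "\<forall>\<^sub>F A in F. A \<in> S"
    unfolding ev by (rule bexI[of _ "({}, 1)"]) (auto simp: I_def B_def)
  moreover have "((\<lambda>A. A x) \<longlongrightarrow> T x) F" for x
  proof (rule tendstoI)
    fix e :: real assume "e > 0"
    then show "\<forall>\<^sub>F A in F. dist (A x) (T x) < e"
      unfolding ev by (intro bexI[of _ "({x}, e)"]) (auto simp: I_def B_def dist_norm norm_minus_commute)
  qed
  ultimately show ?thesis by (rule that)
qed

text \<open>Composition is not jointly continuous for strong convergence in general, but it is along
  contractions: the error \<open>A (g A) - A y\<close> is at most
  \<open>norm (g A - y)\<close>.\<close>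

lemma tendsto_apply_nonexpansive:
  fixes T :: "'a::real_normed_vector \<Rightarrow> 'a"
  assumes T: "\<And>x. ((\<lambda>A. A x) \<longlongrightarrow> T x) F"
    and A: "\<forall>\<^sub>F A in F. \<forall>u v. norm (A u - A v) \<le> norm (u - v)"
    and g: "(g \<longlongrightarrow> y) F"
  shows "((\<lambda>A. A (g A)) \<longlongrightarrow> T y) F"
proof (rule Lim_transform2[OF T])
  have "((\<lambda>A. norm (g A - y)) \<longlongrightarrow> 0) F"
    using g tendsto_norm_zero LIM_zero by blast
  then show "((\<lambda>A. A y - A (g A)) \<longlongrightarrow> 0) F"
  proof (rule Lim_null_comparison[rotated])
    show "\<forall>\<^sub>F A in F. norm (A y - A (g A)) \<le> norm (g A - y)"
      using A by eventually_elim (metis norm_minus_commute)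
  qed
qed

lemma LatD: "P \<in> Lat J B \<Longrightarrow> T \<in> B \<Longrightarrow> T ` range P \<subseteq> range P"
  unfolding Lat_def by (elim CollectE conjE) (erule bspec)

text \<open>Every identity that defines membership in \<open>Lat J B\<close> survives pointwise
  limits; products of varying projections are handled by contractivity.\<close>

lemma sot_closure_Lat:
  assumes J: "cstruct J" and B: "\<And>T. T \<in> B \<Longrightarrow> bounded_linear T"
  shows "sot_closure (Lat J B) \<subseteq> Lat J B"
proof
  fix P assume "P \<in> sot_closure (Lat J B)"
  then obtain F where F: "F \<noteq> bot" "\<forall>\<^sub>F A in F. A \<in> Lat J B" and lim: "\<And>x. ((\<lambda>A. A x) \<longlongrightarrow> P x) F"
    using sot_closure_filter by blast
  have pr: "\<forall>\<^sub>F A in F. is_proj J A" using F(2) by eventually_elim (simp add: Lat_def)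
  have nonexp: "\<forall>\<^sub>F A in F. \<forall>u v. norm (A u - A v) \<le> norm (u - v)"
    using pr by eventually_elim (metis is_projD(1) bounded_linear.linear linear_diff norm_is_proj_le)
  note uniq = tendsto_unique[OF F(1)]
  have "bounded_linear P"
  proof (rule bounded_linear_intro[where K = 1])
    show "P (x + y) = P x + P y" for x y
    proof (rule uniq[OF lim])
      show "((\<lambda>A. A (x + y)) \<longlongrightarrow> P x + P y) F"
        by (rule Lim_transform_eventually[OF tendsto_add[OF lim lim]])
          (use pr in eventually_elim, metis is_projD(1) bounded_linear.linear linear_add)
    qed
    show "P (r *\<^sub>R x) = r *\<^sub>R P x" for r x
    proof (rule uniq[OF lim])
      show "((\<lambda>A. A (r *\<^sub>R x)) \<longlongrightarrow> r *\<^sub>R P x) F"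
        by (rule Lim_transform_eventually[OF tendsto_scaleR[OF tendsto_const lim]])
          (use pr in eventually_elim, metis is_projD(1) bounded_linear.linear linear_scale)
    qed
    show "norm (P x) \<le> norm x * 1" for x
      by (rule tendsto_upperbound[OF tendsto_norm[OF lim] _ F(1)])
        (use pr in eventually_elim, simp add: norm_is_proj_le)
  qed
  moreover have "P (J x) = J (P x)" for x
  proof (rule uniq[OF lim])
    show "((\<lambda>A. A (J x)) \<longlongrightarrow> J (P x)) F"
      by (rule Lim_transform_eventually[OF bounded_linear.tendsto[OF bounded_linear_cstruct[OF J] lim]])
        (use pr in eventually_elim, metis is_projD(2))
  qed
  moreover have "P (P x) = P x" for x
  proof (rule uniq[OF _ lim])
    show "((\<lambda>A. A x) \<longlongrightarrow> P (P x)) F"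
      by (rule Lim_transform_eventually[OF tendsto_apply_nonexpansive[OF lim nonexp lim]])
        (use pr in eventually_elim, metis is_projD(3))
  qed
  moreover have inner_P: "inner (P x) y = inner x (P y)" for x y
  proof (rule uniq)
    show "((\<lambda>A. inner (A x) y) \<longlongrightarrow> inner (P x) y) F" by (intro tendsto_intros lim)
    show "((\<lambda>A. inner (A x) y) \<longlongrightarrow> inner x (P y)) F"
      by (rule Lim_transform_eventually[OF tendsto_inner[OF tendsto_const lim]])
        (use pr in eventually_elim, metis is_projD(4))
  qed
  ultimately have proj: "is_proj J P" by (metis is_proj_def cblin_def cinner_def)
  have "T ` range P \<subseteq> range P" if T: "T \<in> B" for T
  proof -
    \<comment> \<open>Invariance of the range under \<open>T\<close> is the equation
      \<open>P T P = T P\<close>, which passes to the limit; both sides are limits of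
      \<open>A (T (A x))\<close>.\<close>
    have "P (T (P x)) = T (P x)" for x
    proof (rule uniq)
      have TA: "((\<lambda>A. T (A x)) \<longlongrightarrow> T (P x)) F"
        by (rule bounded_linear.tendsto[OF B[OF T] lim])
      show "((\<lambda>A. A (T (A x))) \<longlongrightarrow> P (T (P x))) F"
        by (rule tendsto_apply_nonexpansive[OF lim nonexp TA])
      show "((\<lambda>A. A (T (A x))) \<longlongrightarrow> T (P x)) F"
      proof (rule Lim_transform_eventually[OF TA])
        show "\<forall>\<^sub>F A in F. T (A x) = A (T (A x))"
          using F(2)
        proof eventually_elim
          fix A assume "A \<in> Lat J B"
          then have "is_proj J A" "T (A x) \<in> range A" using T unfolding Lat_def by blast+
          then show "T (A x) = A (T (A x))" using is_proj_fixed_iff by metis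
        qed
      qed
    qed
    then show ?thesis using is_proj_fixed_iff[OF proj] by auto
  qed
  then show "P \<in> Lat J B" using proj by (simp add: Lat_def)
qed

lemma orth_proj_in_Lat:
  assumes J: "cstruct J" and V: "csubspace J V" and B: "\<And>T. T \<in> B \<Longrightarrow> T ` V \<subseteq> V"
  shows "orth_proj V \<in> Lat J B"
  using is_proj_orth_proj[OF J V] B by (simp add: Lat_def)

lemma Lat_ex_range:
  assumes "cstruct J" "csubspace J V" "\<And>T. T \<in> B \<Longrightarrow> T ` V \<subseteq> V"
  shows "\<exists>R\<in>Lat J B. range R = V"
  using orth_proj_in_Lat[OF assms] is_proj_orth_proj(2)[OF assms(1,2)] by blast

text \<open>Used with \<open>Lat J B\<close> as a competitor in the intersection that defines
  \<open>tensor_lattice\<close>, which gives upper bounds for generated lattices.\<close>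

lemma subspace_lattice_Lat:
  assumes J: "cstruct J" and B: "\<And>T. T \<in> B \<Longrightarrow> bounded_linear T"
  shows "subspace_lattice J (Lat J B)"
  unfolding subspace_lattice_def
proof (intro conjI ballI)
  show "is_proj J P" if "P \<in> Lat J B" for P using that by (simp add: Lat_def)
  show "(\<lambda>x. 0) \<in> Lat J B"
    using B by (auto simp: Lat_def is_proj_def cblin_def cinner_def cstructD[OF J] bounded_linear.linear linear_0)
  show "id \<in> Lat J B"
    by (auto simp: Lat_def is_proj_def cblin_def id_def bounded_linear_ident)
  show "sot_closure (Lat J B) \<subseteq> Lat J B" using assms by (rule sot_closure_Lat)
  fix P Q assume PQ: "P \<in> Lat J B" "Q \<in> Lat J B"
  then have V: "csubspace J (range P)" "csubspace J (range Q)" by (auto simp: Lat_def is_proj_csubspace)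
  have inv: "T ` range P \<subseteq> range P" "T ` range Q \<subseteq> range Q" if "T \<in> B" for T
    using PQ that by (auto simp: Lat_def)
  have W: "csubspace J (range P \<inter> range Q)" using V by (rule csubspace_Int)
  show "\<exists>R\<in>Lat J B. range R = range P \<inter> range Q"
  proof (rule Lat_ex_range[OF J W])
    show "T ` (range P \<inter> range Q) \<subseteq> range P \<inter> range Q" if "T \<in> B" for T
      using inv[OF that] by (meson image_Int_subset Int_mono order_trans)
  qed
  have W: "csubspace J (cspan (range P \<union> range Q))"
    using V csubspace_cspan_Union[OF J, of "{range P, range Q}"] by auto
  have "T ` cspan (range P \<union> range Q) \<subseteq> cspan (range P \<union> range Q)" if "T \<in> B" for T
  proof (intro bounded_linear_cspan_subset B that subspace_cspan closed_cspan)
    have "T ` (range P \<union> range Q) \<subseteq> range P \<union> range Q"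
      unfolding image_Un using inv[OF that] by (rule Un_mono)
    then show "T ` (range P \<union> range Q) \<subseteq> cspan (range P \<union> range Q)"
      using subset_cspan by (rule order_trans)
  qed
  then show "\<exists>R\<in>Lat J B. range R = cspan (range P \<union> range Q)"
    by (rule Lat_ex_range[OF J W])
qed

text \<open>Arbitrary joins are strong limits of finite ones. If \<open>C x\<close> is close to some
  \<open>y\<close> in the span of finitely many ranges and \<open>R\<close> is a finite join
  containing them, then \<open>R x = R (C x)\<close> is the point of \<open>range R\<close> nearest
  to \<open>C x\<close>, hence at least as close as \<open>y\<close>.\<close>

lemma subspace_lattice_join_mem:
  assumes J: "cstruct J" and S: "subspace_lattice J S" and A: "\<A> \<subseteq> S"
    and C: "is_proj J C" "range C = cspan (\<Union>P\<in>\<A>. range P)"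
  shows "C \<in> S"
proof -
  have proj: "is_proj J P" if "P \<in> S" for P using S that by (simp add: subspace_lattice_def)
  have fin: "\<exists>R\<in>S. range R = cspan (\<Union>P\<in>\<B>. range P)" if "finite \<B>" "\<B> \<subseteq> S" for \<B>
    using that
  proof (induction \<B> rule: finite_induct)
    case empty
    have "(\<lambda>x. 0) \<in> S" using S by (simp add: subspace_lattice_def)
    then show ?case by (intro bexI[of _ "\<lambda>x. 0"]) (auto simp: cspan_def)
  next
    case (insert P \<B>)
    then obtain R where R: "R \<in> S" "range R = cspan (\<Union>P\<in>\<B>. range P)" by auto
    then obtain R' where R': "R' \<in> S" "range R' = cspan (range P \<union> range R)"
      using S insert.prems unfolding subspace_lattice_def by (metis insert_subset)
    have "cspan (range P \<union> cspan (\<Union>P\<in>\<B>. range P)) = cspan (\<Union>P\<in>insert P \<B>. range P)"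
    proof
      show "cspan (range P \<union> cspan (\<Union>P\<in>\<B>. range P)) \<subseteq> cspan (\<Union>P\<in>insert P \<B>. range P)"
        using cspan_mono[of "\<Union>P\<in>\<B>. range P" "\<Union>P\<in>insert P \<B>. range P"]
          subset_cspan[of "\<Union>P\<in>insert P \<B>. range P"]
        by (intro cspan_minimal subspace_cspan closed_cspan) auto
      show "cspan (\<Union>P\<in>insert P \<B>. range P) \<subseteq> cspan (range P \<union> cspan (\<Union>P\<in>\<B>. range P))"
        using subset_cspan[of "\<Union>P\<in>\<B>. range P"] by (intro cspan_mono) auto
    qed
    then show ?case using R R' by metis
  qed
  have "\<exists>R\<in>S. \<forall>x\<in>X. norm (C x - R x) < e" if X: "finite X" and e: "e > 0" for X e
  proof -
    have "\<exists>\<B>. finite \<B> \<and> \<B> \<subseteq> \<A> \<and> (\<exists>y\<in>span (\<Union>P\<in>\<B>. range P). norm (C x - y) < e)" for x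
    proof -
      have "C x \<in> closure (span (\<Union>P\<in>\<A>. range P))" using C(2) unfolding cspan_def by blast
      then obtain y where y: "y \<in> span (\<Union>P\<in>\<A>. range P)" "dist y (C x) < e"
        using e closure_approachable by blast
      from y(1) obtain t where t: "finite t" "t \<subseteq> (\<Union>P\<in>\<A>. range P)" "y \<in> span t"
        unfolding span_explicit by (auto intro: span_sum span_scale span_base)
      from t(2) obtain h where h: "\<And>a. a \<in> t \<Longrightarrow> h a \<in> \<A> \<and> a \<in> range (h a)"
        unfolding subset_iff UN_iff by metis
      have "t \<subseteq> (\<Union>P\<in>h ` t. range P)" using h by blast
      then have "y \<in> span (\<Union>P\<in>h ` t. range P)" using t(3) span_mono by blast
      moreover have "norm (C x - y) < e" using y(2) by (simp add: dist_norm norm_minus_commute)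
      moreover have "finite (h ` t)" "h ` t \<subseteq> \<A>" using t(1) h by auto
      ultimately show ?thesis by blast
    qed
    then obtain \<B> where \<B>: "\<And>x. finite (\<B> x)" "\<And>x. \<B> x \<subseteq> \<A>"
        "\<And>x. \<exists>y\<in>span (\<Union>P\<in>\<B> x. range P). norm (C x - y) < e" by metis
    \<comment> \<open>One finite join serves all the vectors of \<open>X\<close> at once.\<close>
    obtain R where R: "R \<in> S" "range R = cspan (\<Union>P\<in>(\<Union>x\<in>X. \<B> x). range P)"
      using fin[of "\<Union>x\<in>X. \<B> x"] X \<B>(1,2) A by blast
    have RC: "range R \<subseteq> range C"
      unfolding R(2) C(2) using \<B>(2) by (intro cspan_mono) blast
    have "norm (C x - R x) < e" if x: "x \<in> X" for x
    proof -
      have pR: "is_proj J R" using R(1) proj by blast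
      \<comment> \<open>\<open>R C = R\<close> is the adjoint of \<open>C R = R\<close>, which holds
        since \<open>range R\<close> lies in \<open>range C\<close>.\<close>
      have "inner (R (C x)) y = inner (R x) y" for y
        using RC is_projD(4)[OF pR] is_projD(4)[OF C(1)] is_proj_fixed_iff[OF C(1)] by (metis rangeI subsetD)
      then have eq: "R (C x) = R x" by (rule eq_if_inner_eq)
      obtain y where y: "y \<in> span (\<Union>P\<in>\<B> x. range P)" "norm (C x - y) < e" using \<B>(3) by blast
      have "span (\<Union>P\<in>\<B> x. range P) \<subseteq> range R"
        unfolding R(2) cspan_def using x by (intro order_trans[OF span_mono closure_subset]) blast
      then have "norm (C x - orth_proj (range R) (C x)) \<le> norm (C x - y)"
        using y(1) csubspaceD[OF is_proj_csubspace[OF pR]] by (intro orth_proj_nearest) auto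
      then show ?thesis using y(2) eq is_proj_eq_orth_proj[OF pR] by simp
    qed
    then show ?thesis using R(1) by blast
  qed
  then have "C \<in> sot_closure S" by (auto simp: sot_closure_def)
  then show ?thesis using S by (auto simp: subspace_lattice_def)
qed

section \<open>Complex linearity, rank one operators and orthonormalisation\<close>

lemma cinner_eq_0_iff: "cinner J x y = 0 \<longleftrightarrow> inner x y = 0 \<and> inner x (J y) = 0"
  by (simp add: cinner_def complex_eq_iff)

lemma cinner_cscale_left:
  assumes "cstruct J"
  shows "cinner J (cscale J c x) y = c * cinner J x y"
  by (simp add: cinner_def cscale_def complex_eq_iff inner_add_left cstructD[OF assms])

lemma bounded_linear_cinner_left: "bounded_linear (\<lambda>x. cinner J x y)"
proof -
  have "(\<lambda>x. cinner J x y) = (\<lambda>x. of_real (inner x y) + \<i> * of_real (inner x (J y)))"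
    by (auto simp: cinner_def complex_eq_iff)
  then show ?thesis
    by (auto intro!: bounded_linear_add bounded_linear_const_mult bounded_linear_of_real
        bounded_linear_compose[OF bounded_linear_of_real] bounded_linear_inner_left)
qed

text \<open>\<open>adjoint\<close> refers to the real inner product; both complex structures are
  skew-adjoint, so the two signs cancel.\<close>

lemma adjoint_commutes_cstruct:
  fixes f :: "'a::{real_inner,complete_space} \<Rightarrow> 'b::{real_inner,complete_space}"
  assumes f: "bounded_linear f" "\<And>x. f (J x) = J' (f x)" and J: "cstruct J" "cstruct J'"
  shows "adjoint f (J' z) = J (adjoint f z)"
  by (rule eq_if_inner_eq) (simp add: inner_adjoint[OF f(1)] cstructD(4)[OF J(1)] cstructD(4)[OF J(2)] f(2))

lemma cblin_cscale: "cblin J T \<Longrightarrow> T (cscale J z x) = cscale J z (T x)"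
  by (simp add: cblin_def cscale_def bounded_linear.linear linear_add linear_scale)

lemma Alg_comp: "A \<in> Alg J L \<Longrightarrow> B \<in> Alg J L \<Longrightarrow> (\<lambda>x. A (B x)) \<in> Alg J L"
  unfolding Alg_def cblin_def
proof (intro CollectI conjI ballI)
  assume AB: "A \<in> {T. (bounded_linear T \<and> (\<forall>x. T (J x) = J (T x))) \<and> (\<forall>P\<in>L. T ` range P \<subseteq> range P)}"
    "B \<in> {T. (bounded_linear T \<and> (\<forall>x. T (J x) = J (T x))) \<and> (\<forall>P\<in>L. T ` range P \<subseteq> range P)}"
  show "bounded_linear (\<lambda>x. A (B x))" using AB by (auto intro: bounded_linear_compose)
  show "\<forall>x. A (B (J x)) = J (A (B x))" using AB by simp
  fix P assume "P \<in> L"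
  then have "A ` range P \<subseteq> range P" "B ` range P \<subseteq> range P" using AB by auto
  then show "(\<lambda>x. A (B x)) ` range P \<subseteq> range P" by (metis image_image image_mono order_trans)
qed

lemma id_in_Alg: "id \<in> Alg J L"
  by (simp add: Alg_def cblin_def id_def bounded_linear_ident)

definition rank_one_op :: "('a::real_inner \<Rightarrow> 'a) \<Rightarrow> 'a \<Rightarrow> 'a \<Rightarrow> 'a \<Rightarrow> 'a" where
  "rank_one_op J u v x = cscale J (cinner J x u) v"

lemma cblin_rank_one_op:
  assumes J: "cstruct J"
  shows "cblin J (rank_one_op J u v)"
proof -
  have "rank_one_op J u v = (\<lambda>x. inner x u *\<^sub>R v + inner x (J u) *\<^sub>R J v)"
    by (auto simp: rank_one_op_def cscale_def cinner_def)
  moreover have "bounded_linear (\<lambda>x. inner x u *\<^sub>R v + inner x (J u) *\<^sub>R J v)"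
    by (intro bounded_linear_add bounded_linear_scaleR_const bounded_linear_inner_left)
  moreover have "rank_one_op J u v (J x) = J (rank_one_op J u v x)" for x
    by (simp add: rank_one_op_def cscale_def cinner_def cstructD[OF J])
  ultimately show ?thesis by (simp add: cblin_def)
qed

text \<open>The coefficient of \<open>T x\<close> along \<open>v\<close> is a bounded complex linear
  functional of \<open>x\<close>, represented by the adjoint of \<open>T\<close> at
  \<open>v\<close>, divided by the squared norm of \<open>v\<close>.\<close>

lemma rank_oneE:
  fixes J :: "'a::{real_inner,complete_space} \<Rightarrow> 'a"
  assumes J: "cstruct J" and T: "rank_one J T"
  obtains u v where "T = rank_one_op J u v" "v \<noteq> 0"
proof -
  obtain v where v: "\<And>x. \<exists>z. T x = cscale J z v" and T0: "T \<noteq> (\<lambda>x. 0)" and cT: "cblin J T"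
    using T by (auto simp: rank_one_def)
  have v0: "v \<noteq> 0"
  proof
    assume "v = 0"
    then have "T x = 0" for x using v[of x] by (auto simp: cscale_def cstructD[OF J])
    then show False using T0 by auto
  qed
  have bT: "bounded_linear T" using cT by (simp add: cblin_def)
  define u where "u = (1 / inner v v) *\<^sub>R adjoint T v"
  have "T x = rank_one_op J u v x" for x
  proof -
    obtain z where z: "T x = cscale J z v" using v by blast
    have "inner x u = Re z" using v0 z
      by (simp add: u_def inner_commute[of x] inner_adjoint[OF bT] cscale_def inner_add_right cstructD[OF J])
    moreover have "inner x (J u) = Im z"
    proof -
      \<comment> \<open>The real adjoint yields only the real part of the coefficient; evaluating at
        \<open>J x\<close> brings out the imaginary part.\<close>
      have "T (J x) = cscale J z (J v)"
        using z cT by (simp add: cblin_def cscale_def cstructD[OF J])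
      then have "inner u (J x) = - Im z" using v0
        by (simp add: u_def inner_adjoint[OF bT] cscale_def inner_add_right inner_diff_right cstructD[OF J])
      then show ?thesis using cstructD(4)[OF J, of x u] by (simp add: inner_commute)
    qed
    ultimately show ?thesis using z by (simp add: rank_one_op_def cinner_def)
  qed
  then show ?thesis using that v0 by blast
qed

text \<open>Complex Gram-Schmidt for an arbitrary sequence, possibly linearly dependent:
  \<open>sgn\<close> returns 0 when nothing remains of \<open>k n\<close>, so each
  \<open>e n\<close> is 0 or a unit vector. The last clause says that \<open>k\<close> lies in the
  closed complex span of \<open>e\<close>, in a form that applies directly to preimages.\<close>

lemma gram_schmidt:
  fixes J :: "'a::{real_inner,complete_space} \<Rightarrow> 'a" and k :: "nat \<Rightarrow> 'a"
  assumes J: "cstruct J"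
  shows "\<exists>e :: nat \<Rightarrow> 'a. (\<forall>m n. m \<noteq> n \<longrightarrow> inner (e m) (e n) = 0 \<and> inner (e m) (J (e n)) = 0) \<and>
    (\<forall>n. e n \<noteq> 0 \<longrightarrow> norm (e n) = 1) \<and>
    (\<forall>G. csubspace J G \<longrightarrow> range e \<subseteq> G \<longrightarrow> range k \<subseteq> G)"
proof -
  define V where "V n = cspan (\<Union>i<n. {k i, J (k i)})" for n
  define r where "r n = k n - orth_proj (V n) (k n)" for n
  define e where "e n = sgn (r n)" for n
  have V: "csubspace J (V n)" for n
    unfolding V_def
  proof (rule csubspace_cspan[OF J])
    fix x assume x: "x \<in> (\<Union>i<n. {k i, J (k i)})"
    then obtain i where i: "i < n" "x = k i \<or> x = J (k i)" by blast
    have *: "k i \<in> cspan (\<Union>i<n. {k i, J (k i)})" "J (k i) \<in> cspan (\<Union>i<n. {k i, J (k i)})"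
      using i(1) by (auto intro!: cspan_base)
    show "J x \<in> cspan (\<Union>i<n. {k i, J (k i)})"
      using i(2) * by (auto simp: cstructD[OF J] subspace_neg subspace_cspan)
  qed
  note VD = csubspaceD[OF V]
  have V_mono: "V m \<subseteq> V n" if "m \<le> n" for m n
    unfolding V_def using that by (intro cspan_mono) fastforce
  have "k n \<in> V (Suc n)" for n unfolding V_def by (rule cspan_base) auto
  then have rV: "r n \<in> V (Suc n)" for n
    unfolding r_def using orth_proj_in[OF VD(1,2)] V_mono[of n "Suc n"] VD(1)
    by (intro subspace_diff) auto
  then have eV: "e m \<in> V n" if "m < n" for m n
    using V_mono[of "Suc m" n] that VD(1) by (auto simp: e_def sgn_div_norm intro!: subspace_scale)
  have e_orth: "inner (e n) v = 0" if "v \<in> V n" for n v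
    using that orth_proj_orthogonal[OF VD(1,2)] by (simp add: e_def sgn_div_norm r_def)
  have orth: "inner (e m) (e n) = 0 \<and> inner (e m) (J (e n)) = 0" if "m \<noteq> n" for m n
  proof (cases "m < n")
    case True
    then have "inner (e n) (e m) = 0" "inner (e n) (J (e m)) = 0"
      using eV VD(3) by (auto intro!: e_orth)
    then show ?thesis using cstructD(4)[OF J, of "e n" "e m"] cstructD(4)[OF J, of "e m" "e n"]
      by (simp add: inner_commute)
  next
    case False
    then show ?thesis using eV[of n m] VD(3) that by (auto intro!: e_orth)
  qed
  have unit: "norm (e n) = 1" if "e n \<noteq> 0" for n using that by (auto simp: e_def norm_sgn)
  have gen: "range k \<subseteq> G" if G: "csubspace J G" "range e \<subseteq> G" for G
  proof -
    have "k n \<in> G" for n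
    proof (induction n rule: less_induct)
      case (less n)
      have "V n \<subseteq> G" unfolding V_def
        using less csubspaceD[OF G(1)] by (intro cspan_minimal) auto
      then have "orth_proj (V n) (k n) \<in> G" using orth_proj_in[OF VD(1,2)] by blast
      moreover have "norm (r n) *\<^sub>R e n \<in> G"
        using G by (auto intro!: subspace_scale dest: csubspaceD)
      moreover have "k n = norm (r n) *\<^sub>R e n + orth_proj (V n) (k n)"
        by (cases "r n = 0") (simp_all add: e_def sgn_div_norm, simp_all add: r_def)
      ultimately show ?case using csubspaceD(1)[OF G(1)] subspace_add by metis
    qed
    then show ?thesis by blast
  qed
  show ?thesis
    by (intro exI[of _ e] conjI allI impI) (use orth unit gen in \<open>blast+\<close>)
qed

section \<open>Tensor products\<close>

locale hilbert_tensor =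
  fixes JK :: "'k::{real_inner,complete_space} \<Rightarrow> 'k"
    and JH :: "'h::{real_inner,complete_space} \<Rightarrow> 'h"
    and JT :: "'t::{real_inner,complete_space} \<Rightarrow> 't"
    and tp :: "'k \<Rightarrow> 'h \<Rightarrow> 't"
  assumes JK: "cstruct JK" and JH: "cstruct JH" and JT: "cstruct JT"
    and tensor: "is_tensor_product JK JH JT tp"
begin

lemma tp_JK: "tp (JK x) y = JT (tp x y)"
  and tp_JH: "tp x (JH y) = JT (tp x y)"
  and dense_tp: "cspan (range (case_prod tp)) = UNIV"
  and linear_tp_left: "linear (\<lambda>x. tp x y)"
  and linear_tp_right: "linear (tp x)"
  using tensor by (auto simp: is_tensor_product_def)

lemma inner_tp:
  "inner (tp x y) (tp x' y') = inner x x' * inner y y' - inner x (JK x') * inner y (JH y')"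
proof -
  have "cinner JT (tp x y) (tp x' y') = cinner JK x x' * cinner JH y y'"
    using tensor by (auto simp: is_tensor_product_def)
  from arg_cong[OF this, of Re] show ?thesis by (simp add: cinner_def)
qed

lemma norm_tp: "norm (tp x y) = norm x * norm y"
  by (simp add: norm_eq_sqrt_inner inner_tp cstructD[OF JK] real_sqrt_mult)

lemma bounded_linear_tp_left: "bounded_linear (\<lambda>x. tp x y)"
  using linear_add[OF linear_tp_left] linear_scale[OF linear_tp_left]
  by (intro bounded_linear_intro[where K = "norm y"]) (auto simp: norm_tp)

lemma bounded_linear_tp_right: "bounded_linear (tp x)"
  using linear_tp_right[of x]
  by (intro bounded_linear_intro[where K = "norm x"]) (auto simp: linear_add linear_scale norm_tp)

lemma tp_zero_left [simp]: "tp 0 y = 0" and tp_zero_right [simp]: "tp x 0 = 0"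
  using linear_0[OF linear_tp_left] linear_0[OF linear_tp_right] by auto

lemma tp_cscale_left: "tp (cscale JK c x) y = cscale JT c (tp x y)"
  by (simp add: cscale_def tp_JK linear_add[OF linear_tp_left] linear_scale[OF linear_tp_left])

lemma tp_cscale_right: "tp x (cscale JH c y) = cscale JT c (tp x y)"
  using linear_tp_right[of x] by (simp add: cscale_def linear_add linear_scale tp_JH)

lemma bounded_linear_eq_if_eq_on_tp:
  fixes C D :: "'t \<Rightarrow> 'b::real_normed_vector"
  assumes C: "bounded_linear C" and D: "bounded_linear D" and eq: "\<And>x y. C (tp x y) = D (tp x y)"
  shows "C = D"
proof -
  have "(\<lambda>z. C z - D z) ` cspan (range (case_prod tp)) \<subseteq> {0}"
    using eq by (intro bounded_linear_cspan_subset bounded_linear_sub C D) auto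
  then show ?thesis unfolding dense_tp by (auto simp: image_subset_iff)
qed

lemma eq_if_inner_tp_eq:
  assumes "\<And>x y. inner z (tp x y) = inner z' (tp x y)"
  shows "z = z'"
proof -
  have "inner z = inner z'"
    using assms by (intro bounded_linear_eq_if_eq_on_tp bounded_linear_inner_right)
  then show ?thesis by (simp add: eq_if_inner_eq)
qed

section \<open>Tensor products of subspaces and of projections\<close>

definition tensor_space :: "'k set \<Rightarrow> 'h set \<Rightarrow> 't set" where
  "tensor_space V W = cspan {tp x y | x y. x \<in> V \<and> y \<in> W}"

lemma tp_in_tensor_space: "x \<in> V \<Longrightarrow> y \<in> W \<Longrightarrow> tp x y \<in> tensor_space V W"
  unfolding tensor_space_def by (rule cspan_base) blast

text \<open>\<open>JT\<close> can be moved onto the second factor of an elementary tensor, so the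
  closed real span is already a complex subspace.\<close>

lemma csubspace_tensor_space:
  assumes "\<And>y. y \<in> W \<Longrightarrow> JH y \<in> W"
  shows "csubspace JT (tensor_space V W)"
  unfolding tensor_space_def
proof (rule csubspace_cspan[OF JT])
  fix z assume "z \<in> {tp x y | x y. x \<in> V \<and> y \<in> W}"
  then obtain x y where z: "z = tp x y" "x \<in> V" "y \<in> W" by blast
  have "JT z = tp x (JH y)" by (simp add: z(1) tp_JH)
  then show "JT z \<in> cspan {tp x y | x y. x \<in> V \<and> y \<in> W}"
    using z assms by (intro cspan_base) blast
qed

text \<open>The projection onto \<open>tensor_space (range P) (range Q)\<close> maps
  \<open>tp x y\<close> to \<open>tp (P x) (Q y)\<close>, as the difference is orthogonal to all
  generators. Density of the span of elementary tensors makes it the only such bounded operator, so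
  the description in \<open>tensor_op\<close> denotes it.\<close>

lemma tensor_op_proj:
  assumes P: "is_proj JK P" and Q: "is_proj JH Q"
  shows is_proj_tensor_op: "is_proj JT (tensor_op tp P Q)"
    and range_tensor_op: "range (tensor_op tp P Q) = tensor_space (range P) (range Q)"
    and tensor_op_tp: "tensor_op tp P Q (tp x y) = tp (P x) (Q y)"
proof -
  let ?W = "tensor_space (range P) (range Q)"
  have W: "csubspace JT ?W"
    using csubspaceD(3)[OF is_proj_csubspace[OF Q]] by (rule csubspace_tensor_space)
  note WD = csubspaceD[OF W]
  have W_tp: "orth_proj ?W (tp x y) = tp (P x) (Q y)" for x y
  proof (rule orth_proj_eqI[OF WD(1,2)])
    show "tp (P x) (Q y) \<in> ?W" by (rule tp_in_tensor_space) auto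
    have "inner (tp x y - tp (P x) (Q y)) ` ?W \<subseteq> {0}"
      unfolding tensor_space_def
    proof (intro bounded_linear_cspan_subset bounded_linear_inner_right)
      have "inner (tp x y - tp (P x) (Q y)) (tp (P a) (Q b)) = 0" for a b
        by (simp add: inner_diff_left inner_tp is_projD(3,4)[OF P] is_projD(3,4)[OF Q]
            is_projD(2)[OF P, symmetric] is_projD(2)[OF Q, symmetric])
      then show "inner (tp x y - tp (P x) (Q y)) ` {tp x y | x y. x \<in> range P \<and> y \<in> range Q} \<subseteq> {0}"
        by auto
    qed auto
    then show "inner (tp x y - tp (P x) (Q y)) v = 0" if "v \<in> ?W" for v using that by blast
  qed
  have "tensor_op tp P Q = orth_proj ?W"
    unfolding tensor_op_def
  proof (rule the_equality)
    show "bounded_linear (orth_proj ?W) \<and> (\<forall>x y. orth_proj ?W (tp x y) = tp (P x) (Q y))"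
      using bounded_linear_orth_proj[OF WD(1,2)] W_tp by blast
    then show "C = orth_proj ?W" if "bounded_linear C \<and> (\<forall>x y. C (tp x y) = tp (P x) (Q y))" for C
      using that by (intro bounded_linear_eq_if_eq_on_tp) auto
  qed
  then show "is_proj JT (tensor_op tp P Q)" "range (tensor_op tp P Q) = ?W"
    "tensor_op tp P Q (tp x y) = tp (P x) (Q y)"
    using is_proj_orth_proj[OF JT W] W_tp by auto
qed

section \<open>Contraction of a tensor against a vector of one factor\<close>

text \<open>The operator \<open>C\<^sub>u\<close> of the overview; it sends \<open>tp x y\<close> to
  the multiple of \<open>x\<close> by \<open>cinner JH y u\<close>.\<close>

definition contract_right :: "'h \<Rightarrow> 't \<Rightarrow> 'k" where
  "contract_right u = adjoint (\<lambda>x. tp x u)"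

definition contract_left :: "'k \<Rightarrow> 't \<Rightarrow> 'h" where
  "contract_left e = adjoint (tp e)"

lemma inner_contract_right: "inner (contract_right u z) x = inner z (tp x u)"
  unfolding contract_right_def by (rule inner_adjoint[OF bounded_linear_tp_left])

lemma inner_contract_left: "inner (contract_left e z) y = inner z (tp e y)"
  unfolding contract_left_def by (rule inner_adjoint[OF bounded_linear_tp_right])

lemma bounded_linear_contract_right: "bounded_linear (contract_right u)"
  unfolding contract_right_def by (rule bounded_linear_adjoint[OF bounded_linear_tp_left])

lemma bounded_linear_contract_left: "bounded_linear (contract_left u)"
  unfolding contract_left_def by (rule bounded_linear_adjoint[OF bounded_linear_tp_right])

lemma contract_right_JT: "contract_right u (JT z) = JK (contract_right u z)"
  unfolding contract_right_def
  by (rule adjoint_commutes_cstruct[OF bounded_linear_tp_left _ JK JT]) (rule tp_JK)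

lemma contract_right_tp: "contract_right u (tp x y) = cscale JK (cinner JH y u) x"
  by (rule eq_if_inner_eq)
    (simp add: inner_contract_right inner_tp cscale_def cinner_def inner_add_left cstructD(4)[OF JK])

lemma cinner_contract_left: "cinner JH y (contract_left e w) = cinner JT (tp e y) w"
proof -
  have "inner y (JH (contract_left e w)) = inner (tp e y) (JT w)"
    using inner_contract_left[of e w "JH y"] cstructD(4)[OF JH, of y] cstructD(4)[OF JT, of _ w]
    by (simp add: inner_commute tp_JH)
  then show ?thesis using inner_contract_left[of e w y] by (simp add: cinner_def inner_commute)
qed

text \<open>Pairing \<open>P \<otimes> I\<close> applied to \<open>z\<close> with
  \<open>tp x u\<close> amounts to pairing \<open>P (contract_right u z)\<close> with
  \<open>x\<close>, so membership in \<open>range P \<otimes> H\<close> can be tested slice by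
  slice.\<close>

lemma tensor_op_id_fixed_iff:
  assumes P: "is_proj JK P"
  shows "z \<in> range (tensor_op tp P id) \<longleftrightarrow> (\<forall>u. contract_right u z \<in> range P)"
proof -
  have id: "is_proj JH id" by (simp add: is_proj_def cblin_def id_def bounded_linear_ident)
  note PI = is_proj_tensor_op[OF P id]
  have "z \<in> range (tensor_op tp P id) \<longleftrightarrow> tensor_op tp P id z = z"
    by (rule is_proj_fixed_iff[OF PI])
  also have "\<dots> \<longleftrightarrow> (\<forall>x u. inner (tensor_op tp P id z) (tp x u) = inner z (tp x u))"
    using eq_if_inner_tp_eq by metis
  also have "\<dots> \<longleftrightarrow> (\<forall>u x. inner (P (contract_right u z)) x = inner (contract_right u z) x)"
    by (auto simp: is_projD(4)[OF PI] is_projD(4)[OF P] tensor_op_tp[OF P id] inner_contract_right)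
  also have "\<dots> \<longleftrightarrow> (\<forall>u. P (contract_right u z) = contract_right u z)"
    using eq_if_inner_eq by metis
  finally show ?thesis by (simp add: is_proj_fixed_iff[OF P])
qed

text \<open>\<open>P \<otimes> I\<close> composed with \<open>I \<otimes> Q\<close> is
  \<open>P \<otimes> Q\<close>, as seen on elementary tensors; common fixed points of the two
  factors are fixed by the product.\<close>

lemma range_tensor_op_Int:
  assumes P: "is_proj JK P" and Q: "is_proj JH Q"
  shows "range (tensor_op tp P id) \<inter> range (tensor_op tp id Q) \<subseteq> range (tensor_op tp P Q)"
proof -
  have id: "is_proj JH id" "is_proj JK id" by (auto simp: is_proj_def cblin_def id_def bounded_linear_ident)
  have comp: "(\<lambda>z. tensor_op tp P id (tensor_op tp id Q z)) = tensor_op tp P Q"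
  proof (rule bounded_linear_eq_if_eq_on_tp)
    show "bounded_linear (\<lambda>z. tensor_op tp P id (tensor_op tp id Q z))"
      using is_projD(1)[OF is_proj_tensor_op[OF P id(1)]] is_projD(1)[OF is_proj_tensor_op[OF id(2) Q]]
      by (rule bounded_linear_compose)
    show "bounded_linear (tensor_op tp P Q)" by (rule is_projD(1)[OF is_proj_tensor_op[OF P Q]])
  qed (simp add: tensor_op_tp P Q id)
  then have "tensor_op tp P Q z = z"
    if "z \<in> range (tensor_op tp P id) \<inter> range (tensor_op tp id Q)" for z
  proof -
    have "tensor_op tp P id z = z" "tensor_op tp id Q z = z"
      using that is_proj_fixed_iff[OF is_proj_tensor_op[OF P id(1)]]
        is_proj_fixed_iff[OF is_proj_tensor_op[OF id(2) Q]] by auto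
    then show ?thesis using fun_cong[OF comp, of z] by simp
  qed
  then show ?thesis using is_proj_fixed_iff[OF is_proj_tensor_op[OF P Q]] by blast
qed

section \<open>The lattice generated by tensor products of projections\<close>

lemma tensor_op_in_tensor_lattice:
  "P \<in> L \<Longrightarrow> Q \<in> M \<Longrightarrow> tensor_op tp P Q \<in> tensor_lattice JT tp L M"
  by (auto simp: tensor_lattice_def)

lemma tensor_lattice_subset_Lat:
  assumes B: "\<And>T. T \<in> B \<Longrightarrow> bounded_linear T"
    and L: "\<And>P. P \<in> L \<Longrightarrow> is_proj JK P" and M: "\<And>Q. Q \<in> M \<Longrightarrow> is_proj JH Q"
    and inv: "\<And>T P Q. T \<in> B \<Longrightarrow> P \<in> L \<Longrightarrow> Q \<in> M \<Longrightarrow>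
      T ` range (tensor_op tp P Q) \<subseteq> range (tensor_op tp P Q)"
  shows "tensor_lattice JT tp L M \<subseteq> Lat JT B"
proof -
  have "{tensor_op tp P Q | P Q. P \<in> L \<and> Q \<in> M} \<subseteq> Lat JT B"
  proof clarify
    fix P Q assume PQ: "P \<in> L" "Q \<in> M"
    then show "tensor_op tp P Q \<in> Lat JT B"
      using is_proj_tensor_op[OF L[OF PQ(1)] M[OF PQ(2)]] inv[OF _ PQ] unfolding Lat_def by blast
  qed
  then show ?thesis
    using subspace_lattice_Lat[OF JT B] unfolding tensor_lattice_def by blast
qed

text \<open>The slices of an operator leaving all \<open>N \<otimes> I\<close>, \<open>N \<in> L\<close>, invariant belong to \<open>Alg L\<close>,
  so they leave \<open>P\<close> invariant.\<close>

lemma Alg_tensor_lattice_invariant: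
  assumes L: "subspace_lattice JK L" and M: "subspace_lattice JH M"
    and A: "A \<in> Alg JT (tensor_lattice JT tp L M)"
    and P: "P \<in> Lat JK (Alg JK L)" and Q: "Q \<in> M"
  shows "A ` range (tensor_op tp P Q) \<subseteq> range (tensor_op tp P Q)"
proof -
  have id: "id \<in> L" "id \<in> M" and projL: "\<And>N. N \<in> L \<Longrightarrow> is_proj JK N"
    and projM: "\<And>N. N \<in> M \<Longrightarrow> is_proj JH N"
    using L M by (auto simp: subspace_lattice_def)
  have bA: "bounded_linear A" and AJ: "\<And>z. A (JT z) = JT (A z)"
    using A by (auto simp: Alg_def cblin_def)
  have inv: "A z \<in> range (tensor_op tp N R)" if "N \<in> L" "R \<in> M" "z \<in> range (tensor_op tp N R)" for N R z
    using A tensor_op_in_tensor_lattice[OF that(1,2)] that(3) unfolding Alg_def by blast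
  have pP: "is_proj JK P" using P by (simp add: Lat_def)
  note pQ = projM[OF Q]
  have tp_range: "tp x y \<in> range (tensor_op tp N R)"
    if "is_proj JK N" "is_proj JH R" "x \<in> range N" "y \<in> range R" for N R x y
    using that by (simp add: range_tensor_op tp_in_tensor_space)
  have slice: "(\<lambda>x. contract_right u (A (tp x y))) \<in> Alg JK L" for u y
    unfolding Alg_def cblin_def
  proof (intro CollectI conjI ballI allI image_subsetI)
    show "bounded_linear (\<lambda>x. contract_right u (A (tp x y)))"
      by (intro bounded_linear_compose[OF bounded_linear_contract_right]
          bounded_linear_compose[OF bA] bounded_linear_tp_left)
    show "contract_right u (A (tp (JK x) y)) = JK (contract_right u (A (tp x y)))" for x
      by (simp add: tp_JK AJ contract_right_JT)
    fix N x assume N: "N \<in> L" and x: "x \<in> range N"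
    have "A (tp x y) \<in> range (tensor_op tp N id)"
      using N id x projL projM by (intro inv tp_range) auto
    then show "contract_right u (A (tp x y)) \<in> range N"
      using tensor_op_id_fixed_iff[OF projL[OF N]] by blast
  qed
  \<comment> \<open>The slices place \<open>A (tp x y)\<close> in the range of
    \<open>P \<otimes> I\<close>, and invariance of \<open>I \<otimes> Q\<close> under
    \<open>A\<close> places it in the range of \<open>I \<otimes> Q\<close>.\<close>
  have "A (tp x y) \<in> range (tensor_op tp P Q)" if x: "x \<in> range P" and y: "y \<in> range Q" for x y
  proof -
    have "contract_right u (A (tp x y)) \<in> range P" for u
    proof -
      have "(\<lambda>x. contract_right u (A (tp x y))) ` range P \<subseteq> range P"
        by (rule LatD[OF P slice])
      then show ?thesis using imageI[OF x] by (rule subsetD)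
    qed
    then have "A (tp x y) \<in> range (tensor_op tp P id)"
      using tensor_op_id_fixed_iff[OF pP] by blast
    moreover have "A (tp x y) \<in> range (tensor_op tp id Q)"
      using Q id y projL projM by (intro inv tp_range) auto
    ultimately show ?thesis using range_tensor_op_Int[OF pP pQ] by blast
  qed
  then have "A ` tensor_space (range P) (range Q) \<subseteq> range (tensor_op tp P Q)"
    unfolding tensor_space_def
    using csubspaceD[OF is_proj_csubspace[OF is_proj_tensor_op[OF pP pQ]]]
    by (intro bounded_linear_cspan_subset bA) blast+
  then show ?thesis by (simp add: range_tensor_op[OF pP pQ])
qed

section \<open>Expansion of a tensor along an orthonormal sequence\<close>

lemma csubspace_tp_vimage_left:
  assumes "csubspace JT W"
  shows "csubspace JK {x. \<forall>y. tp x y \<in> W}"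
proof -
  note WD = csubspaceD[OF assms]
  have "{x. \<forall>y. tp x y \<in> W} = (\<Inter>y. (\<lambda>x. tp x y) -` W)" by auto
  then have "closed {x. \<forall>y. tp x y \<in> W}"
    using WD(2) linear_continuous_at[OF bounded_linear_tp_left]
    by (auto intro!: closed_INT continuous_closed_vimage)
  then show ?thesis
    using WD(1,3) linear_add[OF linear_tp_left] linear_scale[OF linear_tp_left]
    by (auto simp: csubspace_def subspace_def tp_JK)
qed

text \<open>A tensor lies in the closed span of countably many elementary tensors, hence in
  \<open>K\<^sub>0 \<otimes> H\<close> for a separable \<open>K\<^sub>0\<close>; \<open>e\<close> orthogonalises a countable dense family of \<open>K\<^sub>0\<close>.\<close>

lemma tensor_expansion:
  obtains e :: "nat \<Rightarrow> 'k"
  where "(\<lambda>n. tp (e n) (contract_left (e n) z)) sums z"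
    and "\<And>w. sq_summable_seq (\<lambda>n. contract_left (e n) w)"
proof -
  have "z \<in> closure (span (range (case_prod tp)))" using dense_tp by (simp add: cspan_def)
  then obtain s where s: "\<And>n. s n \<in> span (range (case_prod tp))" "s \<longlonglongrightarrow> z"
    by (auto simp: closure_sequential)
  have "\<exists>p. finite p \<and> s n \<in> span (case_prod tp ` p)" for n
  proof -
    obtain t where t: "finite t" "t \<subseteq> range (case_prod tp)" "s n \<in> span t"
      using s(1)[of n] unfolding span_explicit by (auto intro: span_sum span_scale span_base)
    then show ?thesis using finite_subset_image[OF t(1,2)] by blast
  qed
  then obtain p where p: "\<And>n. finite (p n)" "\<And>n. s n \<in> span (case_prod tp ` p n)" by metis
  \<comment> \<open>The first factors of all elementary tensors used to approximate
    \<open>z\<close>; 0 is added to make the set nonempty, so that \<open>from_nat_into\<close>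
    enumerates it.\<close>
  define D where "D = insert 0 (\<Union>n. fst ` p n)"
  define k where "k = from_nat_into D"
  have "countable D" unfolding D_def using p(1) by (auto intro: countable_finite)
  then have k: "range k = D" unfolding k_def by (intro range_from_nat_into) (auto simp: D_def)
  obtain e :: "nat \<Rightarrow> 'k" where e: "\<forall>m n. m \<noteq> n \<longrightarrow> inner (e m) (e n) = 0 \<and> inner (e m) (JK (e n)) = 0"
    "\<forall>n. e n \<noteq> 0 \<longrightarrow> norm (e n) = 1"
    "\<forall>G. csubspace JK G \<longrightarrow> range e \<subseteq> G \<longrightarrow> range k \<subseteq> G"
    using gram_schmidt[OF JK, of k] by (elim exE conjE)
  have inner_e: "inner (tp (e m) x) (tp (e n) y) = 0" if "m \<noteq> n" for m n x y
    using e(1) that by (simp add: inner_tp)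
  have inner_e_same: "inner (tp (e m) x) (tp (e m) y) = (if e m = 0 then 0 else inner x y)" for m x y
    using e(2) by (auto simp: inner_tp cstructD[OF JK] norm_eq_sqrt_inner)
  \<comment> \<open>The orthogonal projection onto the span of the spaces
    \<open>e i \<otimes> H\<close> with \<open>i < n\<close>. The facts below give Pythagoras and
    Bessel for it.\<close>
  define W where "W n w = (\<Sum>i<n. tp (e i) (contract_left (e i) w))" for n w
  have W_lin: "bounded_linear (W n)" for n
    unfolding W_def
    by (intro bounded_linear_sum bounded_linear_compose[OF bounded_linear_tp_right]
        bounded_linear_contract_left)
  have inner_W: "inner (W n w) (tp (e j) y) = (if j < n then inner w (tp (e j) y) else 0)" for n w j y
  proof -
    have "inner (W n w) (tp (e j) y) =
        (\<Sum>i<n. if i = j then inner (tp (e j) (contract_left (e j) w)) (tp (e j) y) else 0)"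
      unfolding W_def inner_sum_left by (intro sum.cong refl) (use inner_e in \<open>auto\<close>)
    also have "\<dots> = (if j < n then inner (tp (e j) (contract_left (e j) w)) (tp (e j) y) else 0)"
      by simp
    also have "inner (tp (e j) (contract_left (e j) w)) (tp (e j) y) = inner w (tp (e j) y)"
      unfolding inner_e_same by (auto simp: inner_contract_left)
    finally show ?thesis .
  qed
  have norm_W: "(norm (W n w))\<^sup>2 = (\<Sum>i<n. (norm (contract_left (e i) w))\<^sup>2)" for n w
  proof -
    have "(norm (W n w))\<^sup>2 = (\<Sum>i<n. inner (W n w) (tp (e i) (contract_left (e i) w)))"
      by (simp add: power2_norm_eq_inner inner_sum_right[symmetric] W_def)
    also have "\<dots> = (\<Sum>i<n. (norm (contract_left (e i) w))\<^sup>2)"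
      by (intro sum.cong refl) (simp add: inner_W inner_contract_left power2_norm_eq_inner)
    finally show ?thesis .
  qed
  have norm_W_le: "norm (W n w) \<le> norm w" for n w
  proof -
    have "inner (W n w) (W n w) = inner w (W n w)"
      unfolding W_def[of n w] inner_sum_right
      by (intro sum.cong refl) (simp add: inner_W[unfolded W_def])
    then have "norm (W n w) * norm (W n w) \<le> norm w * norm (W n w)"
      using norm_cauchy_schwarz[of w "W n w"] by (simp add: power2_norm_eq_inner flip: power2_eq_square)
    then show ?thesis by (cases "W n w = 0") auto
  qed
  have "sq_summable_seq (\<lambda>n. contract_left (e n) w)" for w
    unfolding sq_summable_seq_def
  proof (rule bounded_imp_summable)
    show "(\<Sum>i\<le>n. (norm (contract_left (e i) w))\<^sup>2) \<le> (norm w)\<^sup>2" for n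
      using norm_W[of "Suc n" w] power_mono[OF norm_W_le[of "Suc n" w], of 2]
      by (simp add: lessThan_Suc_atMost)
  qed simp
  moreover have "(\<lambda>n. tp (e n) (contract_left (e n) z)) sums z"
  proof -
    define U where "U = cspan (\<Union>i. range (tp (e i)))"
    have U: "csubspace JT U"
      unfolding U_def
    proof (rule csubspace_cspan[OF JT])
      fix x assume "x \<in> (\<Union>i. range (tp (e i)))"
      then obtain i y where "x = tp (e i) y" by blast
      then have "JT x = tp (e i) (JH y)" by (simp add: tp_JH)
      then show "JT x \<in> cspan (\<Union>i. range (tp (e i)))" by (intro cspan_base) blast
    qed
    have "range e \<subseteq> {x. \<forall>y. tp x y \<in> U}" unfolding U_def by (auto intro!: cspan_base)
    \<comment> \<open>The generation clause of Gram-Schmidt, applied to a preimage of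
      \<open>U\<close>, passes from the \<open>e i\<close> to all first factors; hence
      \<open>U\<close> contains every \<open>s n\<close> and the limit \<open>z\<close>.\<close>
    then have "D \<subseteq> {x. \<forall>y. tp x y \<in> U}"
      using e(3) csubspace_tp_vimage_left[OF U] k by blast
    then have "tp x y \<in> U" if "(x, y) \<in> p n" for n x y using that by (force simp: D_def)
    then have "case_prod tp ` p n \<subseteq> U" for n by auto
    then have "s n \<in> U" for n using p(2) span_minimal csubspaceD(1)[OF U] by blast
    then have "z \<in> U" using closed_sequentially[OF csubspaceD(2)[OF U] _ s(2)] by blast
    have stable: "\<exists>N. \<forall>n\<ge>N. W n x = x" if "x \<in> span (\<Union>i. range (tp (e i)))" for x
    proof -
      have "subspace {x. \<exists>N. \<forall>n\<ge>N. W n x = x}"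
        unfolding subspace_def
      proof (intro conjI ballI allI)
        have W: "W n 0 = 0" "W n (x + y) = W n x + W n y" "W n (r *\<^sub>R x) = r *\<^sub>R W n x" for n x y r
          using bounded_linear.linear[OF W_lin] by (auto simp: linear_0 linear_add linear_scale)
        show "0 \<in> {x. \<exists>N. \<forall>n\<ge>N. W n x = x}" using W by simp
        show "r *\<^sub>R x \<in> {x. \<exists>N. \<forall>n\<ge>N. W n x = x}" if "x \<in> {x. \<exists>N. \<forall>n\<ge>N. W n x = x}" for r x
          using that W(3) by fastforce
        fix x y assume "x \<in> {x. \<exists>N. \<forall>n\<ge>N. W n x = x}" "y \<in> {x. \<exists>N. \<forall>n\<ge>N. W n x = x}"
        then obtain N N' where "\<forall>n\<ge>N. W n x = x" "\<forall>n\<ge>N'. W n y = y" by blast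
        then have "\<forall>n\<ge>max N N'. W n (x + y) = x + y" using W(2) by simp
        then show "x + y \<in> {x. \<exists>N. \<forall>n\<ge>N. W n x = x}" by blast
      qed
      moreover have "W n (tp (e i) y) = tp (e i) y" if "n \<ge> Suc i" for n i y
      proof -
        have cl: "tp (e j) (contract_left (e j) (tp (e i) y)) = (if j = i then tp (e i) y else 0)" for j
        proof (cases "e j = 0")
          case True
          then show ?thesis by auto
        next
          case False
          have "contract_left (e j) (tp (e i) y) = (if j = i then y else 0)"
            by (rule eq_if_inner_eq)
              (use False in \<open>auto simp: inner_contract_left inner_e inner_e_same\<close>)
          then show ?thesis by simp
        qed
        show ?thesis unfolding W_def cl using that by simp
      qed
      then have "(\<Union>i. range (tp (e i))) \<subseteq> {x. \<exists>N. \<forall>n\<ge>N. W n x = x}" by blast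
      ultimately show ?thesis using that span_minimal by blast
    qed
    \<comment> \<open>\<open>W n\<close> is eventually the identity at each point of a dense subset
      of \<open>U\<close>, and its norm is at most 1, so convergence extends to
      \<open>z\<close>.\<close>
    have "(\<lambda>n. W n z) \<longlonglongrightarrow> z"
    proof (rule LIMSEQ_I)
      fix r :: real assume "r > 0"
      then obtain x where x: "x \<in> span (\<Union>i. range (tp (e i)))" "dist x z < r / 2"
        using \<open>z \<in> U\<close> unfolding U_def cspan_def by (meson closure_approachable half_gt_zero)
      obtain N where N: "\<And>n. n \<ge> N \<Longrightarrow> W n x = x" using stable[OF x(1)] by blast
      have "norm (W n z - z) < r" if "n \<ge> N" for n
      proof -
        have "W n z - z = W n (z - x) + (x - z)"
          using N[OF that] linear_diff[OF bounded_linear.linear[OF W_lin]] by simp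
        then have "norm (W n z - z) \<le> norm (z - x) + norm (x - z)"
          using norm_triangle_le norm_W_le add_right_mono by metis
        then show ?thesis using x(2) by (simp add: dist_norm norm_minus_commute)
      qed
      then show "\<exists>no. \<forall>n\<ge>no. norm (W n z - z) < r" by blast
    qed
    then show ?thesis by (simp add: sums_def W_def)
  qed
  ultimately show ?thesis using that by blast
qed

end

section \<open>Atoms and rank one operators\<close>

text \<open>The meet of two atoms belongs to the lattice; were it nonzero, minimality would make it
  equal to both.\<close>

lemma atoms_disjoint:
  assumes M: "subspace_lattice J M" and E: "E \<in> atoms M" "E' \<in> atoms M" "E \<noteq> E'"
  shows "range E \<inter> range E' = {0}"
proof -
  obtain R where R: "R \<in> M" "range R = range E \<inter> range E'"
    using M E unfolding subspace_lattice_def atoms_def by blast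
  have "R = (\<lambda>x. 0)"
  proof (rule ccontr)
    assume "R \<noteq> (\<lambda>x. 0)"
    moreover have "range R \<subseteq> range E" "range R \<subseteq> range E'" using R(2) by auto
    ultimately have "R = E" "R = E'" using E(1,2) R(1) unfolding atoms_def by blast+
    then show False using E(3) by simp
  qed
  then show ?thesis using R(2) by auto
qed

text \<open>The orthogonal complement of the join of all atoms other than \<open>E\<close>.\<close>

definition atom_annihilator :: "('a::real_inner \<Rightarrow> 'a) \<Rightarrow> ('a \<Rightarrow> 'a) set \<Rightarrow> ('a \<Rightarrow> 'a) \<Rightarrow> 'a set" where
  "atom_annihilator J M E = {u. \<forall>E'\<in>atoms M - {E}. \<forall>y\<in>range E'. cinner J y u = 0}"

text \<open>Every element of \<open>M\<close> is a join of atoms, so invariance need only be tested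
  on atoms: the operator kills those other than \<open>E\<close> and maps \<open>E\<close> into
  itself.\<close>

lemma rank_one_op_in_Alg:
  assumes J: "cstruct J" and M: "ABSL J M" and E: "E \<in> atoms M"
    and u: "u \<in> atom_annihilator J M E" and v: "v \<in> range E"
  shows "rank_one_op J u v \<in> Alg J M"
proof -
  let ?R = "rank_one_op J u v"
  have cR: "cblin J ?R" using J by (rule cblin_rank_one_op)
  then have bR: "bounded_linear ?R" by (simp add: cblin_def)
  have "?R ` range Q \<subseteq> range Q" if Q: "Q \<in> M" for Q
  proof -
    have "is_proj J Q" using M Q unfolding ABSL_def subspace_lattice_def by blast
    note V = is_proj_csubspace[OF this]
    obtain A where A: "A \<subseteq> atoms M" "range Q = cspan (\<Union>E\<in>A. range E)"
      using M Q unfolding ABSL_def by blast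
    have "?R y \<in> range Q" if E': "E' \<in> A" and y: "y \<in> range E'" for E' y
    proof (cases "E' = E")
      case True
      then have "v \<in> range Q" unfolding A(2) using v E' by (intro cspan_base) blast
      then show ?thesis using csubspace_cscale[OF V] by (simp add: rank_one_op_def)
    next
      case False
      then have "cinner J y u = 0" using u E' y A(1) unfolding atom_annihilator_def by blast
      then show ?thesis using csubspace_zero_mem[OF V] by (simp add: rank_one_op_def cscale_def)
    qed
    then have "?R ` (\<Union>E\<in>A. range E) \<subseteq> range Q" by blast
    then have "?R ` cspan (\<Union>E\<in>A. range E) \<subseteq> range Q"
      using csubspaceD(1,2)[OF V] by (intro bounded_linear_cspan_subset bR)
    then show ?thesis by (simp only: A(2))
  qed
  then show ?thesis using cR by (simp add: Alg_def)
qed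

text \<open>If the functional given by \<open>u\<close> is nonzero on an atom, invariance forces
  \<open>v\<close> into that atom. Atoms meet trivially, so this happens for at most one; they span
  the space, so it happens for at least one.\<close>

lemma rank_one_in_AlgE:
  assumes J: "cstruct J" and M: "ABSL J M" and T: "T \<in> Alg J M" "rank_one J T"
  obtains u v E where "T = rank_one_op J u v" "E \<in> atoms M" "u \<in> atom_annihilator J M E" "v \<in> range E"
proof -
  obtain u v where uv: "T = rank_one_op J u v" "v \<noteq> 0" using rank_oneE[OF J T(2)] by blast
  have lat: "subspace_lattice J M" using M by (simp add: ABSL_def)
  have v_mem: "v \<in> range E" if E: "E \<in> atoms M" and y: "y \<in> range E" "cinner J y u \<noteq> 0" for E y
  proof -
    have EM: "E \<in> M" using E by (simp add: atoms_def)
    then have "is_proj J E" using lat by (simp add: subspace_lattice_def)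
    note V = is_proj_csubspace[OF this]
    have "T y \<in> range E" using T(1) EM y(1) unfolding Alg_def by blast
    then have "cscale J (inverse (cinner J y u)) (cscale J (cinner J y u) v) \<in> range E"
      using csubspace_cscale[OF V] by (simp add: uv(1) rank_one_op_def)
    moreover have "cscale J (inverse c) (cscale J c v) = v" if "c \<noteq> 0" for c
    proof -
      have "cscale J (inverse c) (cscale J c v) = cscale J (inverse c * c) v"
        by (simp add: cscale_def cstructD[OF J] algebra_simps)
      then show ?thesis using that by (simp add: cscale_def)
    qed
    ultimately show ?thesis using y(2) by simp
  qed
  have "\<exists>E\<in>atoms M. v \<in> range E"
  proof (rule ccontr)
    assume none: "\<not> ?thesis"
    have "id \<in> M" using lat by (simp add: subspace_lattice_def)
    then obtain A where A: "A \<subseteq> atoms M" "range id = cspan (\<Union>E\<in>A. range E)"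
      using M unfolding ABSL_def by (metis (no_types, lifting))
    have "cinner J y u = 0" if "E \<in> A" "y \<in> range E" for E y using none v_mem A(1) that by blast
    then have "(\<lambda>y. cinner J y u) ` cspan (\<Union>E\<in>A. range E) \<subseteq> {0}"
      by (intro bounded_linear_cspan_subset bounded_linear_cinner_left) auto
    then have "cinner J y u = 0" for y using A(2) by auto
    then have "T = (\<lambda>x. 0)" by (simp add: uv(1) rank_one_op_def fun_eq_iff cscale_def)
    then show False using T(2) by (simp add: rank_one_def)
  qed
  then obtain E where E: "E \<in> atoms M" "v \<in> range E" by blast
  have "u \<in> atom_annihilator J M E"
    unfolding atom_annihilator_def
  proof (intro CollectI ballI, rule ccontr)
    fix E' y assume E': "E' \<in> atoms M - {E}" and "y \<in> range E'" "cinner J y u \<noteq> 0"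
    then have "v \<in> range E'" using v_mem by blast
    then show False using atoms_disjoint[OF lat E(1), of E'] E E' uv(2) by blast
  qed
  then show ?thesis using that uv(1) E by blast
qed

section \<open>The inclusion \<open>X \<subseteq> S\<close>\<close>

context hilbert_tensor
begin

text \<open>The map is \<open>A \<otimes> R\<close> for the rank one operator \<open>R\<close>,
  written through the contraction so that no general tensor product of operators has to be
  constructed.\<close>

lemma tp_rank_one_op_in_Alg:
  assumes L: "\<And>P. P \<in> L \<Longrightarrow> is_proj JK P" and M: "\<And>Q. Q \<in> M \<Longrightarrow> is_proj JH Q"
    and A: "A \<in> Alg JK L" and R: "rank_one_op JH u v \<in> Alg JH M"
  shows "(\<lambda>z. tp (A (contract_right u z)) v) \<in> Alg JT (tensor_lattice JT tp L M)"
proof -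
  let ?S = "\<lambda>z. tp (A (contract_right u z)) v"
  have bA: "bounded_linear A" "\<And>x. A (JK x) = JK (A x)" and cA: "cblin JK A"
    using A by (auto simp: Alg_def cblin_def)
  have bS: "bounded_linear ?S"
    by (intro bounded_linear_compose[OF bounded_linear_tp_left] bounded_linear_compose[OF bA(1)]
        bounded_linear_contract_right)
  have S_tp: "?S (tp x y) = tp (A x) (rank_one_op JH u v y)" for x y
    by (simp add: contract_right_tp cblin_cscale[OF cA] rank_one_op_def tp_cscale_left tp_cscale_right)
  have "?S ` range (tensor_op tp P Q) \<subseteq> range (tensor_op tp P Q)" if P: "P \<in> L" and Q: "Q \<in> M" for P Q
  proof -
    note W = csubspaceD[OF is_proj_csubspace[OF is_proj_tensor_op[OF L[OF P] M[OF Q]]]]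
    have "A x \<in> range P" if "x \<in> range P" for x using A P that unfolding Alg_def by blast
    moreover have "rank_one_op JH u v y \<in> range Q" if "y \<in> range Q" for y
      using R Q that unfolding Alg_def by blast
    ultimately have "?S ` {tp x y | x y. x \<in> range P \<and> y \<in> range Q} \<subseteq> tensor_space (range P) (range Q)"
      using S_tp tp_in_tensor_space by auto
    then have "?S ` tensor_space (range P) (range Q) \<subseteq> tensor_space (range P) (range Q)"
      unfolding tensor_space_def
      by (intro bounded_linear_cspan_subset bS subspace_cspan closed_cspan)
    then show ?thesis by (simp only: range_tensor_op[OF L[OF P] M[OF Q]])
  qed
  \<comment> \<open>Invariance has been checked on the generators only; it spreads to the generated
    lattice because \<open>Lat JT {?S}\<close> is a subspace lattice.\<close>
  then have sub: "tensor_lattice JT tp L M \<subseteq> Lat JT {?S}"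
    using bS L M by (intro tensor_lattice_subset_Lat) auto
  have "?S ` range P \<subseteq> range P" if "P \<in> tensor_lattice JT tp L M" for P
  proof -
    have "P \<in> Lat JT {?S}" using sub that by (rule subsetD)
    then show ?thesis by (rule LatD) (rule singletonI)
  qed
  moreover have "?S (JT z) = JT (?S z)" for z by (simp add: contract_right_JT bA(2) tp_JK)
  ultimately show ?thesis using bS by (simp add: Alg_def cblin_def)
qed

text \<open>By the expansion of \<open>z\<close>, \<open>B \<mapsto> \<langle>(I \<otimes> B) z, w\<rangle>\<close> is a normal functional. It vanishes on the rank
  one operators of \<open>Alg M\<close>, so by density it vanishes at \<open>B = I\<close>.\<close>

lemma cinner_eq_0_if_rank_one_density:
  assumes M: "ABSL JH M" and dens: "rank_one_density JH M"
    and w: "\<And>E u v. E \<in> atoms M \<Longrightarrow> u \<in> atom_annihilator JH M E \<Longrightarrow> v \<in> range E \<Longrightarrow>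
      cinner JT (tp (contract_right u z) v) w = 0"
  shows "cinner JT z w = 0"
proof -
  obtain e where e: "(\<lambda>n. tp (e n) (contract_left (e n) z)) sums z"
    "\<And>w. sq_summable_seq (\<lambda>n. contract_left (e n) w)"
    using tensor_expansion[of z] by metis
  define x where "x n = contract_left (e n) z" for n
  define y where "y n = contract_left (e n) w" for n
  have xy: "sq_summable_seq x" "sq_summable_seq y" unfolding x_def y_def by (rule e(2))+
  have sums_z: "(\<lambda>n. cinner JH (x n) (y n)) sums cinner JT z w"
    using bounded_linear.sums[OF bounded_linear_cinner_left e(1), of JT w]
    by (simp add: x_def y_def cinner_contract_left)
  have sums_0: "(\<lambda>n. cinner JH (B (x n)) (y n)) sums 0" if B: "B \<in> Alg JH M" "rank_one JH B" for B
  proof -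
    obtain u v E where uv: "B = rank_one_op JH u v" "E \<in> atoms M" "u \<in> atom_annihilator JH M E"
      "v \<in> range E" using rank_one_in_AlgE[OF JH M B] by metis
    \<comment> \<open>This functional is \<open>\<langle>(I \<otimes> B) z, w\<rangle>\<close>.
      Applied termwise to the expansion of \<open>z\<close> it yields the series, and by hypothesis
      its value at \<open>z\<close> is 0.\<close>
    have "bounded_linear (\<lambda>z. cinner JT (tp (contract_right u z) v) w)"
      by (intro bounded_linear_compose[OF bounded_linear_cinner_left]
          bounded_linear_compose[OF bounded_linear_tp_left] bounded_linear_contract_right)
    from bounded_linear.sums[OF this e(1)] show ?thesis
      by (simp add: w[OF uv(2-4)] contract_right_tp uv(1) rank_one_op_def tp_cscale_left
          y_def x_def cinner_contract_left tp_cscale_right)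
  qed
  have "norm (cinner JT z w) < \<epsilon>" if \<epsilon>: "\<epsilon> > 0" for \<epsilon>
  proof -
    have "id \<in> wstar_closure JH (op_cspan JH {T \<in> Alg JH M. rank_one JH T})"
      using dens id_in_Alg unfolding rank_one_density_def by blast
    \<comment> \<open>Weak* approximation of \<open>id\<close>, tested on the single normal
      functional given by the sequences \<open>x\<close> and \<open>y\<close>.\<close>
    then have "\<exists>A\<in>op_cspan JH {T \<in> Alg JH M. rank_one JH T}. \<forall>(x, y)\<in>{(x, y)}.
        norm (\<Sum>n. cinner JH (id (x n) - A (x n)) (y n)) < \<epsilon>"
      unfolding wstar_closure_def using xy \<epsilon> by blast
    then obtain A where A: "A \<in> op_cspan JH {T \<in> Alg JH M. rank_one JH T}"
      "norm (\<Sum>n. cinner JH (x n - A (x n)) (y n)) < \<epsilon>" by auto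
    obtain F c where F: "finite F" "F \<subseteq> {T \<in> Alg JH M. rank_one JH T}"
      "A = (\<lambda>x. \<Sum>B\<in>F. cscale JH (c B) (B x))"
      using A(1) unfolding op_cspan_def by blast
    have lin: "linear (\<lambda>a. cinner JH a b)" for b
      by (rule bounded_linear.linear[OF bounded_linear_cinner_left])
    have "(\<lambda>n. c B * cinner JH (B (x n)) (y n)) sums (c B * 0)" if "B \<in> F" for B
      using that F(2) by (intro sums_mult sums_0) auto
    then have "(\<lambda>n. \<Sum>B\<in>F. c B * cinner JH (B (x n)) (y n)) sums (\<Sum>B\<in>F. c B * 0)"
      by (rule sums_sum)
    then have "(\<lambda>n. cinner JH (A (x n)) (y n)) sums 0"
      by (simp add: F(3) linear_sum[OF lin] cinner_cscale_left[OF JH])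
    from sums_diff[OF sums_z this]
    have "(\<lambda>n. cinner JH (x n - A (x n)) (y n)) sums cinner JT z w"
      by (simp add: linear_diff[OF lin])
    then show ?thesis using A(2) by (simp add: sums_iff)
  qed
  then have "norm (cinner JT z w) \<le> 0" using less_irrefl not_le by blast
  then show ?thesis by simp
qed

lemma Lat_Alg_tensor_decomposition:
  assumes L: "subspace_lattice JK L" and M: "ABSL JH M" and dens: "rank_one_density JH M"
    and Z: "Z \<in> Lat JT (Alg JT (tensor_lattice JT tp L M))"
  shows "\<exists>f. (\<forall>E\<in>atoms M. f E \<in> Lat JK (Alg JK L)) \<and>
    range Z = cspan (\<Union>E\<in>atoms M. range (tensor_op tp (f E) E))"
proof -
  have projL: "is_proj JK P" if "P \<in> L" for P using L that by (simp add: subspace_lattice_def)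
  have projM: "is_proj JH Q" if "Q \<in> M" for Q using M that by (simp add: ABSL_def subspace_lattice_def)
  have pZ: "is_proj JT Z" using Z by (simp add: Lat_def)
  note ZD = csubspaceD[OF is_proj_csubspace[OF pZ]]
  \<comment> \<open>Letting \<open>A\<close> run through the algebra makes the closed span invariant
    under \<open>Alg JK L\<close>; the choice \<open>A = id\<close> keeps the contractions
    themselves in it.\<close>
  define G where "G E = {A (contract_right u z) | A u z.
    A \<in> Alg JK L \<and> u \<in> atom_annihilator JH M E \<and> z \<in> range Z}" for E
  define f where "f E = orth_proj (cspan (G E))" for E
  have cG: "csubspace JK (cspan (G E))" for E
  proof (rule csubspace_cspan[OF JK])
    fix x assume "x \<in> G E"
    then obtain A u z where x: "x = A (contract_right u z)" "A \<in> Alg JK L"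
      "u \<in> atom_annihilator JH M E" "z \<in> range Z" unfolding G_def by blast
    have "JK x = A (contract_right u (JT z))"
      using x(2) by (simp add: x(1) contract_right_JT Alg_def cblin_def)
    then have "JK x \<in> G E" using x ZD(3) unfolding G_def by blast
    then show "JK x \<in> cspan (G E)" by (rule cspan_base)
  qed
  have range_f: "range (f E) = cspan (G E)" for E
    unfolding f_def by (rule is_proj_orth_proj(2)[OF JK cG])
  have f_Lat: "f E \<in> Lat JK (Alg JK L)" for E
    unfolding f_def
  proof (rule orth_proj_in_Lat[OF JK cG])
    fix B assume B: "B \<in> Alg JK L"
    then have bB: "bounded_linear B" by (simp add: Alg_def cblin_def)
    have "B x \<in> G E" if "x \<in> G E" for x
    proof -
      from that obtain A u z where x: "x = A (contract_right u z)" "A \<in> Alg JK L"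
        "u \<in> atom_annihilator JH M E" "z \<in> range Z" unfolding G_def by blast
      show ?thesis unfolding G_def
        by (intro CollectI exI[of _ "\<lambda>x. B (A x)"] exI[of _ u] exI[of _ z])
          (simp add: x Alg_comp[OF B x(2)])
    qed
    then show "B ` cspan (G E) \<subseteq> cspan (G E)"
      by (intro bounded_linear_cspan_subset bB subspace_cspan closed_cspan) (auto intro: cspan_base)
  qed
  have pf: "is_proj JK (f E)" for E using f_Lat by (simp add: Lat_def)
  have pE: "is_proj JH E" if "E \<in> atoms M" for E using that projM by (simp add: atoms_def)
  let ?U = "\<Union>E\<in>atoms M. range (tensor_op tp (f E) E)"
  have cU: "csubspace JT (cspan ?U)"
    using is_proj_csubspace[OF is_proj_tensor_op] pf pE by (intro csubspace_cspan_Union JT) blast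
  have "range (tensor_op tp (f E) E) \<subseteq> range Z" if E: "E \<in> atoms M" for E
  proof -
    have "tp x y \<in> range Z" if x: "x \<in> cspan (G E)" and y: "y \<in> range E" for x y
    proof -
      have "tp x y \<in> range Z" if x: "x \<in> G E" for x
      proof -
        obtain A u z where x: "x = A (contract_right u z)" "A \<in> Alg JK L"
          "u \<in> atom_annihilator JH M E" "z \<in> range Z" using x unfolding G_def by blast
        have "(\<lambda>z. tp (A (contract_right u z)) y) \<in> Alg JT (tensor_lattice JT tp L M)"
          using tp_rank_one_op_in_Alg[OF projL projM x(2) rank_one_op_in_Alg[OF JH M E x(3) y]] .
        then have "(\<lambda>z. tp (A (contract_right u z)) y) ` range Z \<subseteq> range Z"
          by (rule LatD[OF Z])
        then show ?thesis using x(1,4) by blast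
      qed
      then have "(\<lambda>x. tp x y) ` cspan (G E) \<subseteq> range Z"
        by (intro bounded_linear_cspan_subset bounded_linear_tp_left ZD(1,2)) blast
      then show ?thesis using x by blast
    qed
    then show ?thesis unfolding range_tensor_op[OF pf pE[OF E]] range_f tensor_space_def
      by (intro cspan_minimal ZD(1,2)) blast
  qed
  then have "cspan ?U \<subseteq> range Z" by (intro cspan_minimal ZD(1,2)) blast
  moreover have "range Z \<subseteq> cspan ?U"
  proof
    fix z assume z: "z \<in> range Z"
    show "z \<in> cspan ?U"
    proof (rule in_subspace_if_orthogonal[OF csubspaceD(1,2)[OF cU]])
      fix w assume w: "\<And>v. v \<in> cspan ?U \<Longrightarrow> inner v w = 0"
      \<comment> \<open>Real orthogonality to a subspace stable under \<open>JT\<close> is complex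
        orthogonality.\<close>
      have w': "cinner JT v w = 0" if "v \<in> cspan ?U" for v
        using w[OF that] w[OF csubspaceD(3)[OF cU that]]
        by (simp add: cinner_eq_0_iff cstructD(4)[OF JT])
      have "cinner JT z w = 0"
      proof (rule cinner_eq_0_if_rank_one_density[OF M dens])
        fix E u v assume E: "E \<in> atoms M" and u: "u \<in> atom_annihilator JH M E" and v: "v \<in> range E"
        have "id (contract_right u z) \<in> G E" unfolding G_def using u z id_in_Alg by blast
        then have "contract_right u z \<in> range (f E)" unfolding range_f by (simp add: cspan_base)
        then have "tp (contract_right u z) v \<in> range (tensor_op tp (f E) E)"
          using v by (simp add: range_tensor_op[OF pf pE[OF E]] tp_in_tensor_space)
        then show "cinner JT (tp (contract_right u z) v) w = 0"
          using E by (intro w' cspan_base) blast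
      qed
      then show "inner z w = 0" by (simp add: cinner_eq_0_iff)
    qed
  qed
  ultimately show ?thesis using f_Lat by blast
qed

end

section \<open>The cycle of inclusions\<close>

theorem theorem5p1:
  fixes JK :: "'k::{real_inner,complete_space} \<Rightarrow> 'k"
    and JH :: "'h::{real_inner,complete_space} \<Rightarrow> 'h"
    and JT :: "'t::{real_inner,complete_space} \<Rightarrow> 't"
    and tp :: "'k \<Rightarrow> 'h \<Rightarrow> 't"
    and L :: "('k \<Rightarrow> 'k) set" and M :: "('h \<Rightarrow> 'h) set"
  assumes "cstruct JK" and "cstruct JH" and "cstruct JT"
    and "is_tensor_product JK JH JT tp"
    and "subspace_lattice JK L"
    and "ABSL JH M"
    and "rank_one_density JH M"
  shows "Lat JT (Alg JT (tensor_lattice JT tp L M)) = tensor_lattice JT tp (Lat JK (Alg JK L)) M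
       \<and> tensor_lattice JT tp (Lat JK (Alg JK L)) M =
         {C. is_proj JT C \<and> (\<exists>f. (\<forall>E\<in>atoms M. f E \<in> Lat JK (Alg JK L)) \<and>
              range C = cspan (\<Union>E\<in>atoms M. range (tensor_op tp (f E) E)))}"
    (is "?LA = ?TL \<and> ?TL = ?J")
proof -
  interpret hilbert_tensor JK JH JT tp using assms(1-4) by unfold_locales
  have M: "subspace_lattice JH M" using assms(6) by (simp add: ABSL_def)
  have "?LA \<subseteq> ?J"
  proof
    fix Z assume Z: "Z \<in> ?LA"
    then have "is_proj JT Z" by (simp add: Lat_def)
    then show "Z \<in> ?J" using Lat_Alg_tensor_decomposition[OF assms(5-7) Z] by blast
  qed
  moreover have "?J \<subseteq> ?TL"
  proof
    fix C assume "C \<in> ?J"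
    then obtain f where C: "is_proj JT C" and f: "\<And>E. E \<in> atoms M \<Longrightarrow> f E \<in> Lat JK (Alg JK L)"
      and rC: "range C = cspan (\<Union>E\<in>atoms M. range (tensor_op tp (f E) E))" by blast
    \<comment> \<open>\<open>S\<close> here is any of the lattices whose intersection is the tensor
      lattice; each contains the arbitrary join \<open>C\<close> of its members.\<close>
    have "C \<in> S" if S: "subspace_lattice JT S"
      "{tensor_op tp P Q | P Q. P \<in> Lat JK (Alg JK L) \<and> Q \<in> M} \<subseteq> S" for S
    proof (rule subspace_lattice_join_mem[OF JT S(1) _ C])
      have "atoms M \<subseteq> M" by (auto simp: atoms_def)
      then show "(\<lambda>E. tensor_op tp (f E) E) ` atoms M \<subseteq> S" using S(2) f by blast
      show "range C = cspan (\<Union>P\<in>(\<lambda>E. tensor_op tp (f E) E) ` atoms M. range P)" using rC by simp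
    qed
    then show "C \<in> ?TL" unfolding tensor_lattice_def by blast
  qed
  moreover have "?TL \<subseteq> ?LA"
  proof (rule tensor_lattice_subset_Lat)
    show "bounded_linear A" if "A \<in> Alg JT (tensor_lattice JT tp L M)" for A
      using that by (simp add: Alg_def cblin_def)
    show "is_proj JK P" if "P \<in> Lat JK (Alg JK L)" for P using that by (simp add: Lat_def)
    show "is_proj JH Q" if "Q \<in> M" for Q using M that by (simp add: subspace_lattice_def)
  qed (rule Alg_tensor_lattice_invariant[OF assms(5) M])
  ultimately show ?thesis by blast
qed

end
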